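(* For all $0\neq d\in\mathbf{N}I$, $$\chi^{ss}_d=\sum_{d^*}(-1)^{s-1}v^{-\langle d^*\rangle}\chi_{d^1}*\dots*\chi_{d^s},\qquad\langle d^*\rangle=\sum_{1\le k<l\le s}\langle d^l,d^k\rangle,$$ where the sum runs over all tuples $d^*=(d^1,\dots,d^s)$ ($s\ge1$) of nonzero elements of $\mathbf{N}I$ with $\sum_kd^k=d$ such that $\mu(d^1+\dots+d^k)>\mu(d)$ for all $k=1,\dots,s-1$.
   Context: $Q$ is a finite quiver without oriented cycles with vertex set $I$, $r_{ij}$ arrows $i\to j$, Euler form $\langle i,j\rangle=\delta_{ij}-r_{ij}$. $\mathbf{k}$ is a finite field with $v^2$ elements. Fix a weight $\Theta=\sum_i\Theta_ii^*$ ($\Theta_i\in\mathbf Z$), slope $\mu(d)=\Theta(d)/\sum_id_i$ for $d\ne0$; $X$ is semistable if $\mu(\underline{\dim}U)\le\mu(\underline{\dim}X)$ for all nonzero subrepresentations $U$. Hall algebra $\mathcal H=\bigoplus_d\mathcal H_d$ of functions on isoclasses of representations of dimension type $d$, product $(f*g)(X)=v^{\langle e,d\rangle}\sum_{U\subseteq X}f(U)g(X/U)$ for $f\in\mathcal H_d,g\in\mathcal H_e$. $\chi_d$ is the constant function $1$ on representations of dimension type $d$; $\chi^{ss}_d$ is the characteristic function of the semistable ones. *)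

theory Defs
  imports Complex_Main "HOL-Library.Function_Algebras"
begin

text \<open>Quiver: finite vertex type 'i, r i j = number of arrows i -> j; the arrows i -> j
  are indexed by m < r i j.  Dimension vectors are functions 'i => nat.
  A representation of dimension type d over the finite field 'k is given in coordinates:
  X i j m is the (d j x d i)-matrix of the m-th arrow i -> j, entries outside the
  range are zero.  Vectors of k^n are functions nat => 'k vanishing from n on.\<close>

type_synonym 'i dimv = "'i \<Rightarrow> nat"
type_synonym ('i,'k) qrep = "'i \<Rightarrow> 'i \<Rightarrow> nat \<Rightarrow> nat \<Rightarrow> nat \<Rightarrow> 'k"

definition vecs :: "nat \<Rightarrow> (nat \<Rightarrow> 'k::zero) set" where
  "vecs n = {x. \<forall>p. n \<le> p \<longrightarrow> x p = 0}"

definition mapply :: "nat \<Rightarrow> nat \<Rightarrow> (nat \<Rightarrow> nat \<Rightarrow> 'k::comm_semiring_1) \<Rightarrow> (nat \<Rightarrow> 'k) \<Rightarrow> (nat \<Rightarrow> 'k)" where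
  "mapply m n A x = (\<lambda>p. if p < m then (\<Sum>q<n. A p q * x q) else 0)"

definition is_subspace :: "nat \<Rightarrow> (nat \<Rightarrow> 'k::field) set \<Rightarrow> bool" where
  "is_subspace n W \<longleftrightarrow> W \<subseteq> vecs n \<and> (\<lambda>_. 0) \<in> W
     \<and> (\<forall>x\<in>W. \<forall>y\<in>W. (\<lambda>p. x p + y p) \<in> W) \<and> (\<forall>c. \<forall>x\<in>W. (\<lambda>p. c * x p) \<in> W)"

definition sdim :: "nat \<Rightarrow> (nat \<Rightarrow> 'k::field) set \<Rightarrow> nat" where
  "sdim n W = (THE k. \<exists>P. inj_on (mapply n k P) (vecs k) \<and> mapply n k P ` vecs k = W)"

definition Rep :: "('i \<Rightarrow> 'i \<Rightarrow> nat) \<Rightarrow> 'i dimv \<Rightarrow> ('i,'k::zero) qrep set" where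
  "Rep r d = {M. \<forall>i j m p q. M i j m p q \<noteq> 0 \<longrightarrow> m < r i j \<and> p < d j \<and> q < d i}"

definition subrep :: "('i \<Rightarrow> 'i \<Rightarrow> nat) \<Rightarrow> 'i dimv \<Rightarrow> ('i,'k::field) qrep \<Rightarrow> ('i \<Rightarrow> (nat \<Rightarrow> 'k) set) \<Rightarrow> bool" where
  "subrep r d X U \<longleftrightarrow> (\<forall>i. is_subspace (d i) (U i))
     \<and> (\<forall>i j m. m < r i j \<longrightarrow> (\<forall>x\<in>U i. mapply (d j) (d i) (X i j m) x \<in> U j))"

definition subdimv :: "'i dimv \<Rightarrow> ('i \<Rightarrow> (nat \<Rightarrow> 'k::field) set) \<Rightarrow> 'i dimv" where
  "subdimv d U = (\<lambda>i. sdim (d i) (U i))"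

definition euler :: "('i::finite \<Rightarrow> 'i \<Rightarrow> nat) \<Rightarrow> 'i dimv \<Rightarrow> 'i dimv \<Rightarrow> int" where
  "euler r d e = (\<Sum>i\<in>UNIV. int (d i) * int (e i))
      - (\<Sum>i\<in>UNIV. \<Sum>j\<in>UNIV. int (r i j) * int (d i) * int (e j))"

definition slope :: "('i::finite \<Rightarrow> int) \<Rightarrow> 'i dimv \<Rightarrow> real" where
  "slope \<Theta> d = real_of_int (\<Sum>i\<in>UNIV. \<Theta> i * int (d i)) / real (\<Sum>i\<in>UNIV. d i)"

definition sub_iso :: "('i \<Rightarrow> 'i \<Rightarrow> nat) \<Rightarrow> 'i dimv \<Rightarrow> ('i,'k::field) qrep \<Rightarrow> ('i \<Rightarrow> (nat \<Rightarrow> 'k) set)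
     \<Rightarrow> 'i dimv \<Rightarrow> ('i,'k) qrep \<Rightarrow> bool" where
  "sub_iso r dX X U e Y \<longleftrightarrow> Y \<in> Rep r e \<and> (\<exists>P. \<forall>i.
      inj_on (mapply (dX i) (e i) (P i)) (vecs (e i))
    \<and> mapply (dX i) (e i) (P i) ` vecs (e i) = U i
    \<and> (\<forall>j m. m < r i j \<longrightarrow> (\<forall>y\<in>vecs (e i).
          mapply (dX j) (dX i) (X i j m) (mapply (dX i) (e i) (P i) y)
        = mapply (dX j) (e j) (P j) (mapply (e j) (e i) (Y i j m) y))))"

definition quot_iso :: "('i \<Rightarrow> 'i \<Rightarrow> nat) \<Rightarrow> 'i dimv \<Rightarrow> ('i,'k::field) qrep \<Rightarrow> ('i \<Rightarrow> (nat \<Rightarrow> 'k) set)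
     \<Rightarrow> 'i dimv \<Rightarrow> ('i,'k) qrep \<Rightarrow> bool" where
  "quot_iso r dX X U e Y \<longleftrightarrow> Y \<in> Rep r e \<and> (\<exists>R. \<forall>i.
      mapply (e i) (dX i) (R i) ` vecs (dX i) = vecs (e i)
    \<and> {x\<in>vecs (dX i). mapply (e i) (dX i) (R i) x = (\<lambda>_. 0)} = U i
    \<and> (\<forall>j m. m < r i j \<longrightarrow> (\<forall>x\<in>vecs (dX i).
          mapply (e j) (dX j) (R j) (mapply (dX j) (dX i) (X i j m) x)
        = mapply (e j) (e i) (Y i j m) (mapply (e i) (dX i) (R i) x))))"

text \<open>value f(U) of f in H_dF at (the isoclass of) U, and g(X/U) for g in H_eG\<close>
definition hval_sub :: "('i \<Rightarrow> 'i \<Rightarrow> nat) \<Rightarrow> 'i dimv \<Rightarrow> ('i,'k::field) qrep \<Rightarrow> ('i \<Rightarrow> (nat \<Rightarrow> 'k) set)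
     \<Rightarrow> 'i dimv \<Rightarrow> (('i,'k) qrep \<Rightarrow> real) \<Rightarrow> real" where
  "hval_sub r dX X U dF f = (if \<exists>Y. sub_iso r dX X U dF Y then f (SOME Y. sub_iso r dX X U dF Y) else 0)"

definition hval_quot :: "('i \<Rightarrow> 'i \<Rightarrow> nat) \<Rightarrow> 'i dimv \<Rightarrow> ('i,'k::field) qrep \<Rightarrow> ('i \<Rightarrow> (nat \<Rightarrow> 'k) set)
     \<Rightarrow> 'i dimv \<Rightarrow> (('i,'k) qrep \<Rightarrow> real) \<Rightarrow> real" where
  "hval_quot r dX X U eG g = (if \<exists>Y. quot_iso r dX X U eG Y then g (SOME Y. quot_iso r dX X U eG Y) else 0)"

text \<open>Hall product f * g for f in H_dF, g in H_eG (an element of H_(dF+eG)); v = sqrt |k|\<close>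
definition hmult :: "('i::finite \<Rightarrow> 'i \<Rightarrow> nat) \<Rightarrow> 'i dimv \<Rightarrow> (('i,'k::{field,finite}) qrep \<Rightarrow> real)
     \<Rightarrow> 'i dimv \<Rightarrow> (('i,'k) qrep \<Rightarrow> real) \<Rightarrow> ('i,'k) qrep \<Rightarrow> real" where
  "hmult r dF f eG g X = sqrt (real (card (UNIV :: 'k set))) powi (euler r eG dF) *
     (\<Sum>U\<in>{U. subrep r (dF + eG) X U}. hval_sub r (dF + eG) X U dF f * hval_quot r (dF + eG) X U eG g)"

definition chi :: "('i \<Rightarrow> 'i \<Rightarrow> nat) \<Rightarrow> 'i dimv \<Rightarrow> ('i,'k::zero) qrep \<Rightarrow> real" where
  "chi r d X = (if X \<in> Rep r d then 1 else 0)"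

definition semistable :: "('i::finite \<Rightarrow> 'i \<Rightarrow> nat) \<Rightarrow> ('i \<Rightarrow> int) \<Rightarrow> 'i dimv \<Rightarrow> ('i,'k::field) qrep \<Rightarrow> bool" where
  "semistable r \<Theta> d X \<longleftrightarrow> X \<in> Rep r d \<and>
     (\<forall>U. subrep r d X U \<and> subdimv d U \<noteq> 0 \<longrightarrow> slope \<Theta> (subdimv d U) \<le> slope \<Theta> d)"

definition chi_ss :: "('i::finite \<Rightarrow> 'i \<Rightarrow> nat) \<Rightarrow> ('i \<Rightarrow> int) \<Rightarrow> 'i dimv \<Rightarrow> ('i,'k::field) qrep \<Rightarrow> real" where
  "chi_ss r \<Theta> d X = (if semistable r \<Theta> d X then 1 else 0)"

text \<open>chi_(d^1) * ... * chi_(d^s) (bracketed to the right; the product is associative)\<close>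
fun chiprod :: "('i::finite \<Rightarrow> 'i \<Rightarrow> nat) \<Rightarrow> 'i dimv list \<Rightarrow> ('i,'k::{field,finite}) qrep \<Rightarrow> real" where
  "chiprod r [] = chi r 0"
| "chiprod r [d] = chi r d"
| "chiprod r (d # e # ds) = hmult r d (chi r d) (sum_list (e # ds)) (chiprod r (e # ds))"

definition hn_tuples :: "('i::finite \<Rightarrow> int) \<Rightarrow> 'i dimv \<Rightarrow> 'i dimv list set" where
  "hn_tuples \<Theta> d = {ds. ds \<noteq> [] \<and> (\<forall>x\<in>set ds. x \<noteq> 0) \<and> sum_list ds = d \<and>
      (\<forall>k. 1 \<le> k \<and> k < length ds \<longrightarrow> slope \<Theta> (sum_list (take k ds)) > slope \<Theta> d)}"

definition tuple_form :: "('i::finite \<Rightarrow> 'i \<Rightarrow> nat) \<Rightarrow> 'i dimv list \<Rightarrow> int" where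
  "tuple_form r ds = (\<Sum>l<length ds. \<Sum>k<l. euler r (ds ! l) (ds ! k))"

end

theory Submission
  imports Defs "HOL-Library.Cardinality" "HOL-Library.FuncSet"
begin

text \<open>
  Evaluated at \<open>X\<close>, the product of the \<open>\<chi>\<close>'s for a tuple \<open>d\<^sup>*\<close> is \<open>v\<close> to the power of the tuple form
  times the number of flags of subrepresentations of \<open>X\<close> with successive quotients of dimension types
  \<open>d\<^sup>1, d\<^sup>2, \<dots>\<close>. So the right-hand side is the alternating sum over all chains in the poset \<open>P\<close> of
  subrepresentations of slope larger than that of \<open>X\<close>. It is 1 if \<open>P\<close> is empty, that is, if \<open>X\<close> is
  semistable. Otherwise choose \<open>u\<close> maximizing the additive function \<open>\<phi>(U) = \<Theta>(U) |d| - \<Theta>(d) |U|\<close>,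
  whose positivity characterizes \<open>P\<close>. From \<open>\<phi>(U + u) + \<phi>(U \<inter> u) = \<phi>(U) + \<phi>(u)\<close> and \<open>\<phi>(U \<inter> u) \<le> \<phi>(u)\<close>
  it follows that \<open>P\<close> is closed under \<open>U \<mapsto> U + u\<close>, hence conically contractible, and the sum is 0.
  Over a finite field all dimension counts reduce to cardinalities.
\<close>

section \<open>Linear algebra over a finite field\<close>

definition smul :: "'k::field \<Rightarrow> (nat \<Rightarrow> 'k) \<Rightarrow> nat \<Rightarrow> 'k" where
  "smul c x = (\<lambda>p. c * x p)"

definition unitv :: "nat \<Rightarrow> nat \<Rightarrow> 'k::zero_neq_one" where
  "unitv q = (\<lambda>p. if p = q then 1 else 0)"

text \<open>Pointwise addition and \<open>smul\<close> make all functions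
  \<open>nat \<Rightarrow> 'k\<close> one vector space. The spaces \<open>vecs n\<close> are
  subspaces of it, so bases, spans and linear maps from the library apply to them.\<close>

interpretation vf: vector_space "smul :: 'k::field \<Rightarrow> (nat \<Rightarrow> 'k) \<Rightarrow> nat \<Rightarrow> 'k"
  by unfold_locales (auto simp: smul_def plus_fun_def fun_eq_iff algebra_simps)

interpretation vp: vector_space_pair
  "smul :: 'k::field \<Rightarrow> (nat \<Rightarrow> 'k) \<Rightarrow> nat \<Rightarrow> 'k" "smul :: 'k::field \<Rightarrow> (nat \<Rightarrow> 'k) \<Rightarrow> nat \<Rightarrow> 'k" ..

lemma is_subspace_iff: "is_subspace n W \<longleftrightarrow> W \<subseteq> vecs n \<and> vf.subspace W"
  by (auto simp: is_subspace_def vf.subspace_def smul_def plus_fun_def zero_fun_def)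

lemma sum_fun_apply: "(\<Sum>i\<in>A. f i) p = (\<Sum>i\<in>A. (f i p :: 'k::comm_monoid_add))"
  by (induction A rule: infinite_finite_induct) auto

lemma subspace_vecs: "vf.subspace (vecs n :: (nat \<Rightarrow> 'k::field) set)"
  by (auto simp: vf.subspace_def vecs_def smul_def)

lemma unitv_in_vecs [simp]: "q < n \<Longrightarrow> unitv q \<in> vecs n"
  by (auto simp: unitv_def vecs_def)

lemma vecs_expansion: "x \<in> vecs n \<Longrightarrow> x = (\<Sum>q<n. smul (x q) (unitv q))"
  by (auto simp: fun_eq_iff sum_fun_apply smul_def unitv_def vecs_def if_distrib
      cong: if_cong)

lemma linear_mapply: "Vector_Spaces.linear smul smul (mapply m n A)"
  by (auto simp: Vector_Spaces.linear_iff fun_eq_iff mapply_def smul_def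
      vf.vector_space_axioms algebra_simps sum.distrib sum_distrib_left)

lemma mapply_in_vecs [simp]: "mapply m n A x \<in> vecs m"
  by (auto simp: mapply_def vecs_def)

lemma mapply_columns:
  assumes "\<And>q. q < n \<Longrightarrow> c q \<in> vecs m" and "\<And>p q. p < m \<Longrightarrow> q < n \<Longrightarrow> A p q = c q p"
  shows "mapply m n A x = (\<Sum>q<n. smul (x q) (c q))"
  using assms by (auto simp: fun_eq_iff mapply_def sum_fun_apply smul_def vecs_def mult.commute)

text \<open>The columns of the matrix are the values of \<open>g\<close> on the unit vectors; a
  vector of \<open>vecs n\<close> is the combination of unit vectors with its own entries as
  coefficients.\<close>

lemma linear_matrix:
  assumes "Vector_Spaces.linear smul smul g" and "\<And>x. x \<in> vecs n \<Longrightarrow> g x \<in> vecs m"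
  shows "\<exists>A. \<forall>x\<in>vecs n. g x = mapply m n A x"
proof (intro exI ballI)
  fix x :: "nat \<Rightarrow> 'a" assume "x \<in> vecs n"
  then have "g x = g (\<Sum>q<n. smul (x q) (unitv q))" using vecs_expansion by metis
  also have "\<dots> = (\<Sum>q<n. smul (x q) (g (unitv q)))"
    by (simp add: vp.linear_sum[OF assms(1)] vp.linear_scale[OF assms(1)])
  also have "\<dots> = mapply m n (\<lambda>p q. g (unitv q) p) x"
    by (rule mapply_columns[symmetric]) (auto intro: assms(2))
  finally show "g x = mapply m n (\<lambda>p q. g (unitv q) p) x" .
qed

lemma mapply_compose:
  fixes A B :: "nat \<Rightarrow> nat \<Rightarrow> 'k::field"
  shows "\<exists>C. \<forall>x\<in>vecs n. mapply k m B (mapply m n A x) = mapply k n C x"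
proof -
  have "Vector_Spaces.linear smul smul (mapply k m B \<circ> mapply m n A)"
    by (rule Vector_Spaces.linear_compose[OF linear_mapply linear_mapply])
  from linear_matrix[OF this, of n k] show ?thesis by simp
qed

text \<open>Universal property of a quotient in coordinates: the columns of \<open>A\<close> are the
  values of \<open>G\<close> on lifts of the unit vectors through \<open>R\<close>. Two lifts of a
  vector differ by an element of the kernel of \<open>R\<close>, where \<open>G\<close> vanishes.
  The support condition is the one that \<open>Rep\<close> imposes.\<close>

lemma mapply_factor_surj:
  fixes G R :: "nat \<Rightarrow> nat \<Rightarrow> 'k::field"
  assumes surj: "mapply k n R ` vecs n = vecs k"
    and ker: "\<And>x. x \<in> vecs n \<Longrightarrow> mapply k n R x = 0 \<Longrightarrow> mapply m n G x = 0"
  shows "\<exists>A. (\<forall>p q. A p q \<noteq> 0 \<longrightarrow> p < m \<and> q < k)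
      \<and> (\<forall>x\<in>vecs n. mapply m n G x = mapply m k A (mapply k n R x))"
proof -
  have "\<exists>s. s \<in> vecs n \<and> mapply k n R s = unitv q" if "q < k" for q
    using surj unitv_in_vecs[OF that] by (metis imageE)
  then obtain s where s: "\<And>q. q < k \<Longrightarrow> s q \<in> vecs n \<and> mapply k n R (s q) = unitv q" by metis
  define A where "A = (\<lambda>p q. if p < m \<and> q < k then mapply m n G (s q) p else 0)"
  have "mapply m n G x = mapply m k A (mapply k n R x)" if x: "x \<in> vecs n" for x
  proof -
    define y where "y = mapply k n R x"
    \<comment> \<open>The chosen lift of \<open>y\<close>, a combination of the lifted unit vectors;
      \<open>x - x'\<close> lies in the kernel of \<open>R\<close>.\<close>
    define x' where "x' = (\<Sum>q<k. smul (y q) (s q))"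
    have x': "x' \<in> vecs n" unfolding x'_def
      by (intro vf.subspace_sum vf.subspace_scale subspace_vecs) (use s in auto)
    have "mapply k n R x' = (\<Sum>q<k. smul (y q) (unitv q))"
      unfolding x'_def using s
      by (simp add: vp.linear_sum[OF linear_mapply] vp.linear_scale[OF linear_mapply])
    also have "\<dots> = y" by (rule vecs_expansion[symmetric]) (simp add: y_def)
    finally have "mapply k n R (x - x') = 0"
      by (simp add: vp.linear_diff[OF linear_mapply] y_def)
    then have "mapply m n G (x - x') = 0"
      by (intro ker vf.subspace_diff[OF subspace_vecs] x x')
    then have "mapply m n G x = mapply m n G x'"
      by (simp add: vp.linear_diff[OF linear_mapply])
    also have "\<dots> = (\<Sum>q<k. smul (y q) (mapply m n G (s q)))"
      unfolding x'_def
      by (simp add: vp.linear_sum[OF linear_mapply] vp.linear_scale[OF linear_mapply])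
    also have "\<dots> = mapply m k A y"
      by (rule mapply_columns[symmetric]) (auto simp: A_def)
    finally show ?thesis by (simp add: y_def)
  qed
  moreover have "\<forall>p q. A p q \<noteq> 0 \<longrightarrow> p < m \<and> q < k" by (auto simp: A_def)
  ultimately show ?thesis by blast
qed

text \<open>The counterpart for subspaces: each column of \<open>A\<close> is a chosen preimage
  under \<open>P\<close> of the value of \<open>G\<close> on a unit vector.\<close>

lemma mapply_factor_image:
  fixes G P :: "nat \<Rightarrow> nat \<Rightarrow> 'k::field"
  assumes "\<And>y. y \<in> vecs k \<Longrightarrow> mapply m k G y \<in> mapply m l P ` vecs l"
  shows "\<exists>A. (\<forall>p q. A p q \<noteq> 0 \<longrightarrow> p < l \<and> q < k)
      \<and> (\<forall>y\<in>vecs k. mapply m k G y = mapply m l P (mapply l k A y))"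
proof -
  have "\<exists>c. c \<in> vecs l \<and> mapply m l P c = mapply m k G (unitv q)" if "q < k" for q
    using assms[OF unitv_in_vecs[OF that]] by (metis imageE)
  then obtain c where c: "\<And>q. q < k \<Longrightarrow> c q \<in> vecs l \<and> mapply m l P (c q) = mapply m k G (unitv q)"
    by metis
  define A where "A = (\<lambda>p q. if p < l \<and> q < k then c q p else 0)"
  have "mapply m k G y = mapply m l P (mapply l k A y)" if y: "y \<in> vecs k" for y
  proof -
    have "mapply l k A y = (\<Sum>q<k. smul (y q) (c q))"
      by (rule mapply_columns) (use c in \<open>auto simp: A_def\<close>)
    then have "mapply m l P (mapply l k A y) = (\<Sum>q<k. smul (y q) (mapply m k G (unitv q)))"
      using c by (simp add: vp.linear_sum[OF linear_mapply] vp.linear_scale[OF linear_mapply])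
    also have "\<dots> = mapply m k G (\<Sum>q<k. smul (y q) (unitv q))"
      by (simp add: vp.linear_sum[OF linear_mapply] vp.linear_scale[OF linear_mapply])
    also have "\<dots> = mapply m k G y" using vecs_expansion[OF y] by simp
    finally show ?thesis by simp
  qed
  moreover have "\<forall>p q. A p q \<noteq> 0 \<longrightarrow> p < l \<and> q < k" by (auto simp: A_def)
  ultimately show ?thesis by blast
qed

section \<open>Counting forms of the dimension formulas\<close>

lemma card_fibres:
  assumes "finite A" and "\<And>y. y \<in> f ` A \<Longrightarrow> card {x \<in> A. f x = y} = k"
  shows "card A = k * card (f ` A)"
proof -
  have "card A = (\<Sum>y\<in>f ` A. \<Sum>x\<in>{x \<in> A. f x = y}. 1)"
    using sum.image_gen[OF assms(1), of "\<lambda>_. 1::nat" f] by simp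
  also have "\<dots> = k * card (f ` A)" using assms(2) by simp
  finally show ?thesis .
qed

text \<open>Rank and nullity in multiplicative form: each nonempty fibre is a coset of the
  kernel.\<close>

lemma card_linear_image:
  assumes f: "Vector_Spaces.linear smul smul f" and A: "vf.subspace A" "finite A"
  shows "card A = card {x \<in> A. f x = 0} * card (f ` A)"
proof (rule card_fibres[OF A(2)])
  fix y assume "y \<in> f ` A"
  then obtain x0 where x0: "x0 \<in> A" "y = f x0" by auto
  have "bij_betw (\<lambda>t. t + x0) {x \<in> A. f x = 0} {x \<in> A. f x = y}"
  proof (rule bij_betwI[where g = "\<lambda>x. x - x0"])
    show "(\<lambda>t. t + x0) \<in> {x \<in> A. f x = 0} \<rightarrow> {x \<in> A. f x = y}"
      using x0 A by (auto intro: vf.subspace_add simp: vp.linear_add[OF f])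
    show "(\<lambda>x. x - x0) \<in> {x \<in> A. f x = y} \<rightarrow> {x \<in> A. f x = 0}"
      using x0 A by (auto intro: vf.subspace_diff simp: vp.linear_diff[OF f])
  qed auto
  then show "card {x \<in> A. f x = y} = card {x \<in> A. f x = 0}"
    by (simp add: bij_betw_same_card)
qed

text \<open>Every fibre of the addition map on \<open>A \<times> B\<close> is a copy of
  \<open>A \<inter> B\<close>, embedded by \<open>t \<mapsto> (x0 + t, y0 - t)\<close>.\<close>

lemma card_subspace_sum:
  assumes A: "vf.subspace A" "finite A" and B: "vf.subspace B" "finite B"
  shows "card A * card B = card (A \<inter> B) * card ((\<lambda>(x, y). x + y) ` (A \<times> B))"
  unfolding card_cartesian_product[of A B, symmetric]
proof (rule card_fibres)
  fix z assume "z \<in> (\<lambda>(x, y). x + y) ` (A \<times> B)"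
  then obtain x0 y0 where x0: "x0 \<in> A" "y0 \<in> B" "z = x0 + y0" by auto
  have "bij_betw (\<lambda>t. (x0 + t, y0 - t)) (A \<inter> B) {u \<in> A \<times> B. (case u of (x, y) \<Rightarrow> x + y) = z}"
  proof (rule bij_betwI[where g = "\<lambda>(x, y). x - x0"])
    show "(\<lambda>t. (x0 + t, y0 - t)) \<in> A \<inter> B \<rightarrow> {u \<in> A \<times> B. (case u of (x, y) \<Rightarrow> x + y) = z}"
      using x0 A B by (auto intro: vf.subspace_add vf.subspace_diff)
    have "x - x0 \<in> A \<inter> B" if "x \<in> A" "y \<in> B" "x + y = x0 + y0" for x y
    proof -
      have "x - x0 = y0 - y" using that(3) by (simp add: algebra_simps)
      then show ?thesis using that x0 A B by (metis IntI vf.subspace_diff)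
    qed
    then show "(\<lambda>(x, y). x - x0) \<in> {u \<in> A \<times> B. (case u of (x, y) \<Rightarrow> x + y) = z} \<rightarrow> A \<inter> B"
      using x0 by auto
  qed (use x0 in \<open>auto simp: algebra_simps\<close>)
  then show "card {u \<in> A \<times> B. (case u of (x, y) \<Rightarrow> x + y) = z} = card (A \<inter> B)"
    by (simp add: bij_betw_same_card)
qed (use A B in auto)

lemma vecs_Suc: "vecs (Suc n) = (\<lambda>(x, c). x(n := c)) ` (vecs n \<times> UNIV)"
proof
  show "vecs (Suc n) \<subseteq> (\<lambda>(x, c). x(n := c)) ` (vecs n \<times> (UNIV :: 'a set))"
  proof
    fix y :: "nat \<Rightarrow> 'a" assume "y \<in> vecs (Suc n)"
    then have "y(n := 0) \<in> vecs n" by (auto simp: vecs_def)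
    then show "y \<in> (\<lambda>(x, c). x(n := c)) ` (vecs n \<times> UNIV)"
      by (intro image_eqI[of _ _ "(y(n := 0), y n)"]) auto
  qed
qed (auto simp: vecs_def)

lemma card_vecs:
  "finite (vecs n :: (nat \<Rightarrow> 'k::{zero,finite}) set)
    \<and> card (vecs n :: (nat \<Rightarrow> 'k) set) = CARD('k) ^ n"
proof (induction n)
  case 0
  have "vecs 0 = {\<lambda>_. 0 :: 'k}" by (auto simp: vecs_def)
  then show ?case by simp
next
  case (Suc n)
  have "inj_on (\<lambda>(x, c). x(n := c)) (vecs n \<times> (UNIV :: 'k set))"
  proof (rule inj_onI, clarsimp)
    fix x y :: "nat \<Rightarrow> 'k" and c c' :: 'k
    assume *: "x \<in> vecs n" "y \<in> vecs n" "x(n := c) = y(n := c')"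
    have "x p = y p" for p
      using *(1,2) fun_cong[OF *(3), of p] by (cases "p = n") (simp_all add: vecs_def)
    then show "x = y \<and> c = c'" using fun_cong[OF *(3), of n] by auto
  qed
  then show ?case unfolding vecs_Suc using Suc by (simp add: card_image card_cartesian_product)
qed

lemmas finite_vecs [simp] = card_vecs[THEN conjunct1]

section \<open>Frames, dimensions and cokernels\<close>

lemma one_less_card_field: "1 < CARD('k::{field,finite})"
  using card_mono[of UNIV "{0, 1 :: 'k}"] by simp

text \<open>The matrix with the members of \<open>B\<close> as columns: independence makes it
  injective, and its image consists of the combinations of \<open>B\<close>. This is the kind of
  witness that \<open>sdim\<close> asks for.\<close>

lemma independent_frame:
  fixes B :: "(nat \<Rightarrow> 'k::field) set"
  assumes "finite B" and "vf.independent B" and "B \<subseteq> vecs n"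
  shows "\<exists>P. inj_on (mapply n (card B) P) (vecs (card B))
      \<and> mapply n (card B) P ` vecs (card B) = vf.span B"
proof -
  let ?k = "card B"
  obtain b where b: "bij_betw b {..<?k} B"
    using ex_bij_betw_nat_finite[OF assms(1)] by (auto simp: lessThan_atLeast0)
  define P where "P = (\<lambda>p q. b q p)"
  have P: "mapply n ?k P x = (\<Sum>q<?k. smul (x q) (b q))" for x
    by (rule mapply_columns) (use b assms(3) in \<open>auto simp: P_def bij_betw_def\<close>)
  \<comment> \<open>The same combination indexed by \<open>B\<close> instead of positions, the form
    in which linear independence is applied.\<close>
  have P': "mapply n ?k P x = (\<Sum>v\<in>B. smul (x (inv_into {..<?k} b v)) v)" for x
    unfolding P sum.reindex_bij_betw[OF b, symmetric]
    using b by (intro sum.cong) (auto simp: bij_betw_def inv_into_f_f)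
  have "inj_on (mapply n ?k P) (vecs ?k)"
  proof (rule inj_onI)
    fix x y assume *: "x \<in> vecs ?k" "y \<in> vecs ?k" "mapply n ?k P x = mapply n ?k P y"
    have "mapply n ?k P (x - y) = 0"
      using *(3) by (simp add: vp.linear_diff[OF linear_mapply])
    then have 0: "(\<Sum>v\<in>B. smul ((x - y) (inv_into {..<?k} b v)) v) = 0" by (simp only: P')
    have "x q = y q" if "q < ?k" for q
    proof -
      have "b q \<in> B" using b that by (auto simp: bij_betw_def)
      from vf.independentD[OF assms(2,1) order_refl 0 this]
      show ?thesis using b that by (simp add: bij_betw_def inv_into_f_f)
    qed
    moreover have "x q = y q" if "\<not> q < ?k" for q using * that by (auto simp: vecs_def)
    ultimately show "x = y" by (metis ext)
  qed
  moreover have "mapply n ?k P ` vecs ?k = vf.span B"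
  proof
    show "mapply n ?k P ` vecs ?k \<subseteq> vf.span B"
      unfolding P' by (intro image_subsetI vf.span_sum vf.span_scale vf.span_base)
    show "vf.span B \<subseteq> mapply n ?k P ` vecs ?k"
    proof
      fix z assume "z \<in> vf.span B"
      then obtain u where u: "z = (\<Sum>v\<in>B. smul (u v) v)"
        using vf.span_finite[OF assms(1)] by auto
      have "z = mapply n ?k P (\<lambda>q. if q < ?k then u (b q) else 0)"
        unfolding u P sum.reindex_bij_betw[OF b, symmetric] by simp
      then show "z \<in> mapply n ?k P ` vecs ?k" by (auto simp: vecs_def)
    qed
  qed
  ultimately show ?thesis by blast
qed

lemma card_frame:
  fixes P :: "nat \<Rightarrow> nat \<Rightarrow> 'k::{field,finite}"
  assumes "inj_on (mapply n k P) (vecs k)" and "mapply n k P ` vecs k = W"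
  shows "card W = CARD('k) ^ k"
  using card_image[OF assms(1)] assms(2) card_vecs by metis

text \<open>The description in \<open>sdim\<close> is unambiguous, because frames of sizes
  \<open>k\<close> and \<open>l\<close> for the same \<open>W\<close> give
  \<open>CARD('k) ^ k = CARD('k) ^ l\<close>.\<close>

lemma sdim_eqI:
  fixes P :: "nat \<Rightarrow> nat \<Rightarrow> 'k::{field,finite}"
  assumes "inj_on (mapply n k P) (vecs k)" and "mapply n k P ` vecs k = W"
  shows "sdim n W = k"
  unfolding sdim_def
proof (rule the_equality)
  fix l assume "\<exists>P. inj_on (mapply n l P) (vecs l) \<and> mapply n l P ` vecs l = W"
  then have "CARD('k) ^ l = CARD('k) ^ k" using card_frame card_frame[OF assms] by metis
  then show "l = k" using one_less_card_field[where 'k = 'k] by (simp add: power_inject_exp)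
qed (use assms in blast)

lemma subspace_basis:
  fixes W :: "(nat \<Rightarrow> 'k::{field,finite}) set"
  assumes "is_subspace n W"
  shows "\<exists>B. finite B \<and> vf.independent B \<and> B \<subseteq> W \<and> vf.span B = W \<and> card B = sdim n W"
proof -
  from assms have W: "W \<subseteq> vecs n" "vf.subspace W" by (auto simp: is_subspace_iff)
  obtain B where B: "B \<subseteq> W" "vf.independent B" "W \<subseteq> vf.span B"
    using vf.maximal_independent_subset by metis
  have fin: "finite B" using B(1) W(1) finite_subset[OF _ finite_vecs] by blast
  have span: "vf.span B = W" using B W by (metis vf.span_subspace)
  obtain P where "inj_on (mapply n (card B) P) (vecs (card B))"
    "mapply n (card B) P ` vecs (card B) = W"
    using independent_frame[OF fin B(2), of n] B(1) W(1) span by auto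
  from sdim_eqI[OF this] B span fin show ?thesis by auto
qed

lemma subspace_frame:
  fixes W :: "(nat \<Rightarrow> 'k::{field,finite}) set"
  assumes "is_subspace n W"
  shows "\<exists>P. inj_on (mapply n (sdim n W) P) (vecs (sdim n W))
      \<and> mapply n (sdim n W) P ` vecs (sdim n W) = W"
proof -
  obtain B where B: "finite B" "vf.independent B" "B \<subseteq> W" "vf.span B = W" "card B = sdim n W"
    using subspace_basis[OF assms] by blast
  moreover have "B \<subseteq> vecs n" using B(3) assms by (auto simp: is_subspace_iff)
  ultimately show ?thesis using independent_frame[of B n] by simp
qed

lemma card_subspace:
  fixes W :: "(nat \<Rightarrow> 'k::{field,finite}) set"
  assumes "is_subspace n W"
  shows "card W = CARD('k) ^ sdim n W"
  using subspace_frame[OF assms] card_frame by blast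

text \<open>A basis \<open>B\<close> of \<open>W\<close> is extended to a basis \<open>C\<close> of
  \<open>vecs n\<close>; the linear map \<open>g\<close> kills \<open>B\<close> and carries
  \<open>C - B\<close> bijectively to the unit vectors of \<open>vecs e\<close>.\<close>

lemma subspace_cokernel:
  fixes W :: "(nat \<Rightarrow> 'k::{field,finite}) set"
  assumes W: "is_subspace n W" and n: "n = sdim n W + e"
  shows "\<exists>R. mapply e n R ` vecs n = vecs e \<and> {x \<in> vecs n. mapply e n R x = 0} = W"
proof -
  have Wsub: "W \<subseteq> vecs n" "vf.subspace W" using W by (auto simp: is_subspace_iff)
  obtain B where B: "finite B" "vf.independent B" "B \<subseteq> W" "vf.span B = W" "card B = sdim n W"
    using subspace_basis[OF W] by blast
  obtain C where C: "B \<subseteq> C" "C \<subseteq> vecs n" "vf.independent C" "vecs n \<subseteq> vf.span C"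
    using vf.maximal_independent_subset_extend[of B "vecs n"] B Wsub by (metis order_trans)
  have fC: "finite C" using C(2) finite_subset[OF _ finite_vecs] by blast
  have spanC: "vf.span C = vecs n" using C by (metis vf.span_subspace subspace_vecs)
  have "CARD('k) ^ card C = CARD('k) ^ n"
    using independent_frame[OF fC C(3,2)] card_frame[of n "card C" _ "vecs n"] spanC card_vecs
    by metis
  then have "card C = n" using one_less_card_field[where 'k = 'k] by (simp add: power_inject_exp)
  then have "card (C - B) = e" using B(1,5) C(1) n by (simp add: card_Diff_subset)
  then obtain h where h: "bij_betw h (C - B) {..<e}"
    using ex_bij_betw_finite_nat[of "C - B"] fC by (auto simp: lessThan_atLeast0)
  obtain g where g: "Vector_Spaces.linear smul smul g"
    "\<And>x. x \<in> C \<Longrightarrow> g x = (if x \<in> B then 0 else unitv (h x))"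
    using vp.linear_independent_extend[OF C(3), of "\<lambda>x. if x \<in> B then 0 else unitv (h x)"] by blast
  have gimg: "g ` vecs n = vf.span (g ` C)"
    using vp.linear_span_image[OF g(1)] spanC by simp
  have gC: "g x \<in> vecs e" if "x \<in> C" for x
  proof (cases "x \<in> B")
    case True
    then show ?thesis using g(2)[OF that] vf.subspace_0[OF subspace_vecs] by simp
  next
    case False
    then have "h x < e" using h that by (auto simp: bij_betw_def)
    then show ?thesis using g(2)[OF that] False by simp
  qed
  have "unitv q \<in> g ` C" if "q < e" for q
  proof -
    have "q \<in> h ` (C - B)" using h that by (simp add: bij_betw_def)
    then obtain x where "x \<in> C - B" "h x = q" by auto
    then show ?thesis using g(2)[of x] by (metis DiffD1 DiffD2 imageI)
  qed
  then have "vecs e \<subseteq> vf.span (g ` C)"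
  proof (intro subsetI)
    fix x :: "nat \<Rightarrow> 'k" assume u: "\<And>q. q < e \<Longrightarrow> unitv q \<in> g ` C" and x: "x \<in> vecs e"
    have "(\<Sum>q<e. smul (x q) (unitv q)) \<in> vf.span (g ` C)"
      using u by (intro vf.span_sum vf.span_scale vf.span_base) auto
    then show "x \<in> vf.span (g ` C)" using vecs_expansion[OF x] by simp
  qed
  moreover have "vf.span (g ` C) \<subseteq> vecs e"
    using gC by (intro vf.span_minimal subspace_vecs) auto
  ultimately have surj: "g ` vecs n = vecs e" using gimg by simp
  obtain R where R: "\<And>x. x \<in> vecs n \<Longrightarrow> g x = mapply e n R x"
    using linear_matrix[OF g(1), of n e] surj imageI[of _ _ g] by metis
  let ?K = "{x \<in> vecs n. g x = 0}"
  \<comment> \<open>The kernel contains \<open>W\<close>; by rank and nullity it has as many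
    elements, so the two coincide.\<close>
  have "CARD('k) ^ n = card ?K * CARD('k) ^ e"
    using card_linear_image[OF g(1) subspace_vecs, of n] surj card_vecs[where 'k = 'k] by simp
  then have "card ?K = card W"
    unfolding card_subspace[OF W] using n one_less_card_field[where 'k = 'k]
    by (metis mult_right_cancel not_one_less_zero power_add power_not_zero)
  moreover have "W \<subseteq> ?K"
  proof -
    have "vf.span B \<subseteq> {x. g x = 0}"
      using B(3) g(2) C(1) by (intro vf.span_minimal vp.linear_subspace_kernel g(1)) auto
    then show ?thesis using B(4) Wsub by auto
  qed
  ultimately have "W = ?K" by (intro card_subset_eq) auto
  moreover have "mapply e n R ` vecs n = vecs e" using surj R by (metis image_cong)
  ultimately show ?thesis using R by (intro exI[of _ R]) auto
qed

lemma sdim_eq_card: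
  fixes W :: "(nat \<Rightarrow> 'k::{field,finite}) set"
  assumes "is_subspace n W" and "card W = CARD('k) ^ k"
  shows "sdim n W = k"
  using card_subspace[OF assms(1)] assms(2) one_less_card_field[where 'k = 'k]
  by (simp add: power_inject_exp)

lemma sdim_mono:
  fixes V W :: "(nat \<Rightarrow> 'k::{field,finite}) set"
  assumes "is_subspace n V" and "is_subspace n W" and "V \<subseteq> W"
  shows "sdim n V \<le> sdim n W"
proof -
  have "finite W" using assms(2) finite_subset[OF _ finite_vecs] by (auto simp: is_subspace_iff)
  then have "CARD('k) ^ sdim n V \<le> CARD('k) ^ sdim n W"
    using card_mono[OF _ assms(3)] card_subspace assms(1,2) by metis
  then show ?thesis using one_less_card_field[where 'k = 'k] by simp
qed

lemma sdim_subset_eq: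
  fixes V W :: "(nat \<Rightarrow> 'k::{field,finite}) set"
  assumes "is_subspace n V" and "is_subspace n W" and "V \<subseteq> W" and "sdim n V = sdim n W"
  shows "V = W"
proof (rule card_subset_eq)
  show "finite W" using assms(2) finite_subset[OF _ finite_vecs] by (auto simp: is_subspace_iff)
qed (use assms card_subspace in metis)+

lemma is_subspace_vecs: "is_subspace n (vecs n)"
  by (simp add: is_subspace_iff subspace_vecs)

lemma sdim_vecs: "sdim n (vecs n :: (nat \<Rightarrow> 'k::{field,finite}) set) = n"
  by (rule sdim_eq_card[OF is_subspace_vecs]) (simp add: card_vecs)

lemma is_subspace_zero: "is_subspace n {0}"
  by (auto simp: is_subspace_iff vecs_def)

lemma sdim_zero: "sdim n ({0} :: (nat \<Rightarrow> 'k::{field,finite}) set) = 0"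
  by (rule sdim_eq_card[OF is_subspace_zero]) simp

section \<open>Subrepresentations and quotients\<close>

lemma subrep_iff:
  "subrep r d X U \<longleftrightarrow> (\<forall>i. is_subspace (d i) (U i))
    \<and> (\<forall>i j m x. m < r i j \<longrightarrow> x \<in> U i \<longrightarrow> mapply (d j) (d i) (X i j m) x \<in> U j)"
  by (auto simp: subrep_def)

lemma subrep_subspace:
  assumes "subrep r d X U"
  shows "is_subspace (d i) (U i)" "vf.subspace (U i)" "U i \<subseteq> vecs (d i)"
  using assms by (auto simp: subrep_def is_subspace_iff)

lemma subrep_arrow:
  "subrep r d X U \<Longrightarrow> m < r i j \<Longrightarrow> x \<in> U i \<Longrightarrow> mapply (d j) (d i) (X i j m) x \<in> U j"
  by (auto simp: subrep_def)

text \<open>Ensures that the sums over subrepresentations are genuine and do not take the default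
  value 0 of a sum over an infinite set.\<close>

lemma finite_subreps:
  "finite {U :: 'i::finite \<Rightarrow> (nat \<Rightarrow> 'k::{field,finite}) set. subrep r d X U}"
proof (rule finite_subset)
  show "{U. subrep r d X U} \<subseteq> (\<Pi>\<^sub>E i\<in>UNIV. Pow (vecs (d i)))"
    by (auto simp: PiE_UNIV_domain dest: subrep_subspace(3))
qed (auto intro!: finite_PiE)

lemma subdimv_mono:
  fixes U :: "'i \<Rightarrow> (nat \<Rightarrow> 'k::{field,finite}) set"
  assumes "subrep r d X U" and "subrep r d X V" and "U \<le> V"
  shows "subdimv d U \<le> subdimv d V"
  using assms sdim_mono[OF subrep_subspace(1)[OF assms(1)] subrep_subspace(1)[OF assms(2)]]
  by (simp add: le_fun_def subdimv_def)

text \<open>Nested subspaces of equal dimension coincide at each vertex, so a proper inclusion is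
  visible in the dimension type.\<close>

lemma subdimv_strict_mono:
  fixes U :: "'i \<Rightarrow> (nat \<Rightarrow> 'k::{field,finite}) set"
  assumes "subrep r d X U" and "subrep r d X V" and "U < V"
  shows "subdimv d U < subdimv d V"
proof -
  have "subdimv d U \<noteq> subdimv d V"
  proof
    assume *: "subdimv d U = subdimv d V"
    have "U i = V i" for i
      using sdim_subset_eq[OF subrep_subspace(1)[OF assms(1)] subrep_subspace(1)[OF assms(2)]]
        assms(3) fun_cong[OF *, of i] by (auto simp: subdimv_def less_fun_def le_fun_def)
    then show False using assms(3) by (auto simp: less_fun_def le_fun_def)
  qed
  then show ?thesis using subdimv_mono[OF assms(1,2)] assms(3) by (simp add: order_less_le)
qed

lemma subdimv_le:
  fixes U :: "'i \<Rightarrow> (nat \<Rightarrow> 'k::{field,finite}) set"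
  assumes "subrep r d X U"
  shows "subdimv d U \<le> d"
  unfolding le_fun_def subdimv_def
proof
  fix i show "sdim (d i) (U i) \<le> d i"
    using sdim_mono[OF subrep_subspace(1)[OF assms, of i] is_subspace_vecs subrep_subspace(3)[OF assms, of i]]
    by (simp add: sdim_vecs)
qed

section \<open>The lattice of subrepresentations\<close>

lemma subrep_bot: "subrep r d X (\<lambda>_. {0})"
  using is_subspace_zero by (auto simp: subrep_iff vp.linear_0[OF linear_mapply])

lemma subdimv_bot: "subdimv d (\<lambda>_. {0 :: nat \<Rightarrow> 'k::{field,finite}}) = 0"
  by (auto simp: subdimv_def sdim_zero)

lemma subrep_inter:
  assumes "subrep r d X U" and "subrep r d X V"
  shows "subrep r d X (\<lambda>i. U i \<inter> V i)"
  using assms by (auto simp: subrep_iff is_subspace_iff vf.subspace_inter)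

definition rep_sum :: "('i \<Rightarrow> (nat \<Rightarrow> 'k::field) set) \<Rightarrow> ('i \<Rightarrow> (nat \<Rightarrow> 'k) set) \<Rightarrow> 'i \<Rightarrow> (nat \<Rightarrow> 'k) set" where
  "rep_sum U V = (\<lambda>i. (\<lambda>(x, y). x + y) ` (U i \<times> V i))"

lemma rep_sumI: "x \<in> U i \<Longrightarrow> y \<in> V i \<Longrightarrow> x + y \<in> rep_sum U V i"
  by (auto simp: rep_sum_def)

lemma subrep_rep_sum:
  assumes U: "subrep r d X U" and V: "subrep r d X V"
  shows "subrep r d X (rep_sum U V)"
  unfolding subrep_iff
proof (intro conjI allI impI)
  fix i
  have "rep_sum U V i = {x + y |x y. x \<in> U i \<and> y \<in> V i}" by (auto simp: rep_sum_def)
  then have "vf.subspace (rep_sum U V i)"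
    using vf.subspace_sums[OF subrep_subspace(2)[OF U] subrep_subspace(2)[OF V]] by simp
  moreover have "rep_sum U V i \<subseteq> vecs (d i)"
    using subrep_subspace(3)[OF U, of i] subrep_subspace(3)[OF V, of i]
    by (auto simp: rep_sum_def intro!: vf.subspace_add[OF subspace_vecs])
  ultimately show "is_subspace (d i) (rep_sum U V i)" by (simp add: is_subspace_iff)
next
  fix i j m x assume "m < r i j" "x \<in> rep_sum U V i"
  then obtain u w where "u \<in> U i" "w \<in> V i" "x = u + w" by (auto simp: rep_sum_def)
  with \<open>m < r i j\<close> show "mapply (d j) (d i) (X i j m) x \<in> rep_sum U V j"
    using subrep_arrow[OF U] subrep_arrow[OF V] by (simp add: vp.linear_add[OF linear_mapply] rep_sumI)
qed

text \<open>Each summand lies in the sum by adding 0 from the other. This is the universal property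
  of the join, in the form used for the contraction.\<close>

lemma rep_sum_le_iff:
  assumes "subrep r d X U" and "subrep r d X V" and "subrep r d X W"
  shows "rep_sum U V \<le> W \<longleftrightarrow> U \<le> W \<and> V \<le> W"
proof
  assume *: "rep_sum U V \<le> W"
  have "x \<in> W i" if "x \<in> U i" for x i
    using rep_sumI[of x U i 0 V, OF that vf.subspace_0[OF subrep_subspace(2)[OF assms(2)]]] * by (auto simp: le_fun_def)
  moreover have "x \<in> W i" if "x \<in> V i" for x i
    using rep_sumI[of 0 U i x V, OF vf.subspace_0[OF subrep_subspace(2)[OF assms(1)]] that] * by (auto simp: le_fun_def)
  ultimately show "U \<le> W \<and> V \<le> W" by (auto simp: le_fun_def)
next
  assume "U \<le> W \<and> V \<le> W"
  then show "rep_sum U V \<le> W"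
    using vf.subspace_add[OF subrep_subspace(2)[OF assms(3)]]
    by (fastforce simp: le_fun_def rep_sum_def)
qed

text \<open>At each vertex this is \<open>card_subspace_sum\<close> with both sides written as
  powers of \<open>CARD('k)\<close>; exponents are then compared.\<close>

lemma subdimv_rep_sum:
  fixes U :: "'i \<Rightarrow> (nat \<Rightarrow> 'k::{field,finite}) set"
  assumes U: "subrep r d X U" and V: "subrep r d X V"
  shows "subdimv d U + subdimv d V = subdimv d (\<lambda>i. U i \<inter> V i) + subdimv d (rep_sum U V)"
proof
  fix i
  have fin: "finite (U i)" "finite (V i)"
    using subrep_subspace(3)[OF U] subrep_subspace(3)[OF V] finite_subset[OF _ finite_vecs] by metis+
  have "card (U i) * card (V i) = card (U i \<inter> V i) * card (rep_sum U V i)"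
    unfolding rep_sum_def
    by (rule card_subspace_sum[OF subrep_subspace(2)[OF U] fin(1) subrep_subspace(2)[OF V] fin(2)])
  then have "CARD('k) ^ (sdim (d i) (U i) + sdim (d i) (V i))
      = CARD('k) ^ (sdim (d i) (U i \<inter> V i) + sdim (d i) (rep_sum U V i))"
    using card_subspace[OF subrep_subspace(1)[OF U, of i]] card_subspace[OF subrep_subspace(1)[OF V, of i]]
      card_subspace[OF subrep_subspace(1)[OF subrep_inter[OF U V], of i]]
      card_subspace[OF subrep_subspace(1)[OF subrep_rep_sum[OF U V], of i]]
    by (simp add: power_add)
  then show "(subdimv d U + subdimv d V) i = (subdimv d (\<lambda>i. U i \<inter> V i) + subdimv d (rep_sum U V)) i"
    using one_less_card_field[where 'k = 'k] by (simp add: subdimv_def power_inject_exp)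
qed

text \<open>Frames at the vertices give coordinates on \<open>U\<close>, and stability under the
  arrows lets the matrices of \<open>X\<close> be rewritten in them. Consequently
  \<open>hval_sub\<close> of \<open>chi r e\<close> is the indicator of dimension type
  \<open>e\<close>.\<close>

lemma sub_iso_iff:
  fixes X :: "('i, 'k::{field,finite}) qrep"
  assumes U: "subrep r d X U"
  shows "(\<exists>Y. sub_iso r d X U e Y) \<longleftrightarrow> subdimv d U = e"
proof
  assume "\<exists>Y. sub_iso r d X U e Y"
  then show "subdimv d U = e" by (auto simp: sub_iso_def subdimv_def fun_eq_iff intro: sdim_eqI)
next
  assume e: "subdimv d U = e"
  then have e': "sdim (d i) (U i) = e i" for i by (auto simp: subdimv_def)
  obtain P where P: "\<And>i. inj_on (mapply (d i) (e i) (P i)) (vecs (e i))"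
      "\<And>i. mapply (d i) (e i) (P i) ` vecs (e i) = U i"
    using subspace_frame[OF subrep_subspace(1)[OF U]] unfolding e' by metis
  \<comment> \<open>Collects what is required of one matrix, so that the whole representation arises
    from independent choices; arrows out of range receive the zero matrix.\<close>
  define Q where "Q = (\<lambda>i j m A. (\<forall>p q. A p q \<noteq> 0 \<longrightarrow> m < r i j \<and> p < e j \<and> q < e i)
      \<and> (m < r i j \<longrightarrow> (\<forall>y\<in>vecs (e i). mapply (d j) (d i) (X i j m) (mapply (d i) (e i) (P i) y)
            = mapply (d j) (e j) (P j) (mapply (e j) (e i) A y))))"
  have "\<exists>A. Q i j m A" for i j m
  proof (cases "m < r i j")
    case True
    obtain G where G: "\<And>y. y \<in> vecs (e i) \<Longrightarrow>
        mapply (d j) (d i) (X i j m) (mapply (d i) (e i) (P i) y) = mapply (d j) (e i) G y"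
      using mapply_compose by blast
    have "mapply (d j) (e i) G y \<in> mapply (d j) (e j) (P j) ` vecs (e j)" if "y \<in> vecs (e i)" for y
    proof -
      have "mapply (d i) (e i) (P i) y \<in> U i" using P(2) that by blast
      then show ?thesis using subrep_arrow[OF U True] G[OF that] P(2) by metis
    qed
    from mapply_factor_image[OF this] show ?thesis using True G by (auto simp: Q_def)
  next
    case False
    then show ?thesis by (intro exI[of _ "\<lambda>_ _. 0"]) (auto simp: Q_def)
  qed
  then obtain Y where Y: "\<And>i j m. Q i j m (Y i j m)" by metis
  then have "sub_iso r d X U e Y"
    unfolding sub_iso_def using P by (intro conjI exI[of _ P]) (auto simp: Rep_def Q_def)
  then show "\<exists>Y. sub_iso r d X U e Y" by (intro exI[of _ Y])
qed

text \<open>Keeps the witness \<open>R\<close> of \<open>quot_iso\<close> explicit, since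
  subrepresentations of the quotient are pulled back along it.\<close>

definition quot_map :: "('i \<Rightarrow> 'i \<Rightarrow> nat) \<Rightarrow> 'i dimv \<Rightarrow> ('i,'k::field) qrep \<Rightarrow> ('i \<Rightarrow> (nat \<Rightarrow> 'k) set)
     \<Rightarrow> 'i dimv \<Rightarrow> ('i,'k) qrep \<Rightarrow> ('i \<Rightarrow> nat \<Rightarrow> nat \<Rightarrow> 'k) \<Rightarrow> bool" where
  "quot_map r d X U e Y R \<longleftrightarrow> (\<forall>i. mapply (e i) (d i) (R i) ` vecs (d i) = vecs (e i)
    \<and> {x \<in> vecs (d i). mapply (e i) (d i) (R i) x = 0} = U i)
    \<and> (\<forall>i j m x. m < r i j \<longrightarrow> x \<in> vecs (d i) \<longrightarrow>
          mapply (e j) (d j) (R j) (mapply (d j) (d i) (X i j m) x)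
        = mapply (e j) (e i) (Y i j m) (mapply (e i) (d i) (R i) x))"

lemma quot_iso_iff: "quot_iso r d X U e Y \<longleftrightarrow> Y \<in> Rep r e \<and> (\<exists>R. quot_map r d X U e Y R)"
  unfolding quot_iso_def quot_map_def zero_fun_def by (intro conj_cong refl ex_cong1) blast

text \<open>Cokernels are chosen vertex by vertex. The arrows descend to them because they map
  \<open>U\<close>, the kernel of \<open>R\<close>, into itself.\<close>

lemma quot_iso_exists:
  fixes X :: "('i, 'k::{field,finite}) qrep"
  assumes U: "subrep r d X U" and d: "d = subdimv d U + e"
  shows "\<exists>Y. quot_iso r d X U e Y"
proof -
  have d': "d i = sdim (d i) (U i) + e i" for i
    using fun_cong[OF d, of i] by (simp add: subdimv_def)
  define K where "K = (\<lambda>i S. mapply (e i) (d i) S ` vecs (d i) = vecs (e i)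
      \<and> {x \<in> vecs (d i). mapply (e i) (d i) S x = 0} = U i)"
  have "\<exists>S. K i S" for i
    unfolding K_def by (rule subspace_cokernel[OF subrep_subspace(1)[OF U] d'])
  then obtain R where "\<And>i. K i (R i)" by metis
  then have R: "mapply (e i) (d i) (R i) ` vecs (d i) = vecs (e i)"
      "{x \<in> vecs (d i). mapply (e i) (d i) (R i) x = 0} = U i" for i
    by (simp_all add: K_def)
  define Q where "Q = (\<lambda>i j m A. (\<forall>p q. A p q \<noteq> 0 \<longrightarrow> m < r i j \<and> p < e j \<and> q < e i)
      \<and> (m < r i j \<longrightarrow> (\<forall>x\<in>vecs (d i). mapply (e j) (d j) (R j) (mapply (d j) (d i) (X i j m) x)
            = mapply (e j) (e i) A (mapply (e i) (d i) (R i) x))))"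
  have "\<exists>A. Q i j m A" for i j m
  proof (cases "m < r i j")
    case True
    obtain G where G: "\<And>x. x \<in> vecs (d i) \<Longrightarrow>
        mapply (e j) (d j) (R j) (mapply (d j) (d i) (X i j m) x) = mapply (e j) (d i) G x"
      using mapply_compose by blast
    have "mapply (e j) (d i) G x = 0"
      if "x \<in> vecs (d i)" "mapply (e i) (d i) (R i) x = 0" for x
    proof -
      have "mapply (d j) (d i) (X i j m) x \<in> U j"
        using subrep_arrow[OF U True] R(2)[of i] that by blast
      then show ?thesis unfolding R(2)[of j, symmetric] using G[OF that(1)] by simp
    qed
    from mapply_factor_surj[OF R(1) this] show ?thesis using True G by (auto simp: Q_def)
  next
    case False
    then show ?thesis by (intro exI[of _ "\<lambda>_ _. 0"]) (auto simp: Q_def)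
  qed
  then obtain Y where Y: "\<And>i j m. Q i j m (Y i j m)" by metis
  then have "Y \<in> Rep r e" "quot_map r d X U e Y R" using R by (auto simp: Rep_def quot_map_def Q_def)
  then show ?thesis by (auto simp: quot_iso_iff)
qed

text \<open>Identity matrices exhibit \<open>X\<close> as its own quotient by 0, which starts the
  count of flags.\<close>

lemma quot_iso_bot:
  assumes "X \<in> Rep r d"
  shows "quot_iso r d X (\<lambda>_. {0}) d X"
proof -
  define R :: "'a \<Rightarrow> nat \<Rightarrow> nat \<Rightarrow> 'b" where "R = (\<lambda>i p q. if p = q then 1 else 0)"
  have R: "mapply (d i) (d i) (R i) x = x" if "x \<in> vecs (d i)" for i x
    using that by (auto simp: mapply_def vecs_def R_def fun_eq_iff if_distrib[of "\<lambda>c. c * _"] cong: if_cong)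
  have "quot_map r d X (\<lambda>_. {0}) d X R"
    unfolding quot_map_def
  proof (intro conjI allI impI)
    fix i
    show "mapply (d i) (d i) (R i) ` vecs (d i) = vecs (d i)" using R by force
    have "(0 :: nat \<Rightarrow> 'b) \<in> vecs (d i)" by (simp add: vecs_def)
    then show "{x \<in> vecs (d i). mapply (d i) (d i) (R i) x = 0} = {0}" using R by auto
  qed (simp add: R)
  then show ?thesis using assms by (auto simp: quot_iso_iff)
qed

section \<open>The correspondence theorem for quotient representations\<close>

definition rep_preimage :: "'i dimv \<Rightarrow> 'i dimv \<Rightarrow> ('i \<Rightarrow> nat \<Rightarrow> nat \<Rightarrow> 'k::field)
     \<Rightarrow> ('i \<Rightarrow> (nat \<Rightarrow> 'k) set) \<Rightarrow> 'i \<Rightarrow> (nat \<Rightarrow> 'k) set" where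
  "rep_preimage d e R W = (\<lambda>i. {x \<in> vecs (d i). mapply (e i) (d i) (R i) x \<in> W i})"

context
  fixes r :: "'i \<Rightarrow> 'i \<Rightarrow> nat" and d e :: "'i dimv" and X Y :: "('i, 'k::{field,finite}) qrep"
    and U :: "'i \<Rightarrow> (nat \<Rightarrow> 'k) set" and R :: "'i \<Rightarrow> nat \<Rightarrow> nat \<Rightarrow> 'k"
  assumes U: "subrep r d X U" and R: "quot_map r d X U e Y R"
begin

lemma quot_map_simps:
  "mapply (e i) (d i) (R i) ` vecs (d i) = vecs (e i)"
  "{x \<in> vecs (d i). mapply (e i) (d i) (R i) x = 0} = U i"
  "m < r i j \<Longrightarrow> x \<in> vecs (d i) \<Longrightarrow> mapply (e j) (d j) (R j) (mapply (d j) (d i) (X i j m) x)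
    = mapply (e j) (e i) (Y i j m) (mapply (e i) (d i) (R i) x)"
  using R by (auto simp: quot_map_def)

lemma subrep_preimage:
  assumes W: "subrep r e Y W"
  shows "subrep r d X (rep_preimage d e R W)" and "U \<le> rep_preimage d e R W"
proof -
  have "vf.subspace (rep_preimage d e R W i)" for i
    using subrep_subspace(2)[OF W, of i] subspace_vecs[where 'k = 'k]
    by (auto simp: rep_preimage_def vf.subspace_def vp.linear_0[OF linear_mapply]
        vp.linear_add[OF linear_mapply] vp.linear_scale[OF linear_mapply])
  then show "subrep r d X (rep_preimage d e R W)"
    using W by (auto simp: subrep_iff is_subspace_iff rep_preimage_def quot_map_simps(3))
  have "x \<in> rep_preimage d e R W i" if "x \<in> U i" for x i
    using that vf.subspace_0[OF subrep_subspace(2)[OF W, of i]]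
    unfolding quot_map_simps(2)[symmetric] by (auto simp: rep_preimage_def)
  then show "U \<le> rep_preimage d e R W" by (auto simp: le_fun_def)
qed

lemma image_rep_preimage:
  assumes "subrep r e Y W"
  shows "mapply (e i) (d i) (R i) ` rep_preimage d e R W i = W i"
  using subrep_subspace(3)[OF assms, of i] quot_map_simps(1)[of i]
  by (auto simp: rep_preimage_def)

text \<open>At each vertex \<open>R\<close> maps the preimage onto \<open>W\<close> with kernel
  \<open>U\<close>, so the cardinalities multiply.\<close>

lemma subdimv_preimage:
  assumes W: "subrep r e Y W"
  shows "subdimv d (rep_preimage d e R W) = subdimv d U + subdimv e W"
proof
  fix i
  let ?V = "rep_preimage d e R W i"
  note V = subrep_preimage[OF W]
  have fin: "finite ?V"
    using subrep_subspace(3)[OF V(1)] finite_subset[OF _ finite_vecs] by metis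
  have ker: "{x \<in> ?V. mapply (e i) (d i) (R i) x = 0} = U i"
    using quot_map_simps(2)[of i] V(2) by (auto simp: le_fun_def rep_preimage_def)
  have "card ?V = card (U i) * card (W i)"
    using card_linear_image[OF linear_mapply subrep_subspace(2)[OF V(1)] fin]
    unfolding ker[symmetric] image_rep_preimage[OF W, of i, symmetric] .
  then have "card ?V = CARD('k) ^ (sdim (d i) (U i) + sdim (e i) (W i))"
    using card_subspace[OF subrep_subspace(1)[OF U, of i]] card_subspace[OF subrep_subspace(1)[OF W, of i]]
    by (simp add: power_add)
  then show "subdimv d (rep_preimage d e R W) i = (subdimv d U + subdimv e W) i"
    using sdim_eq_card[OF subrep_subspace(1)[OF V(1)]] by (simp add: subdimv_def)
qed

text \<open>The inverse is the image under \<open>R\<close>. A subrepresentation \<open>V\<close>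
  above \<open>U\<close> is recovered since vectors with equal images differ by an element of
  \<open>U\<close>.\<close>

lemma bij_betw_preimage:
  "bij_betw (rep_preimage d e R) {W. subrep r e Y W} {V. subrep r d X V \<and> U \<le> V}"
proof (rule bij_betwI[where g = "\<lambda>V i. mapply (e i) (d i) (R i) ` V i"])
  show "rep_preimage d e R \<in> {W. subrep r e Y W} \<rightarrow> {V. subrep r d X V \<and> U \<le> V}"
    using subrep_preimage by auto
next
  have "subrep r e Y (\<lambda>i. mapply (e i) (d i) (R i) ` V i)" if V: "subrep r d X V" for V
    unfolding subrep_iff is_subspace_iff
  proof (intro conjI allI impI)
    fix i j m y assume m: "m < r i j" and "y \<in> mapply (e i) (d i) (R i) ` V i"
    then obtain x where x: "x \<in> V i" "y = mapply (e i) (d i) (R i) x" by auto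
    then have "x \<in> vecs (d i)" "mapply (d j) (d i) (X i j m) x \<in> V j"
      using subrep_arrow[OF V m] subrep_subspace(3)[OF V] by auto
    then show "mapply (e j) (e i) (Y i j m) y \<in> mapply (e j) (d j) (R j) ` V j"
      using quot_map_simps(3)[OF m, of x] x(2) imageI by metis
  qed (auto intro!: vp.linear_subspace_image linear_mapply subrep_subspace(2)[OF V])
  then show "(\<lambda>V i. mapply (e i) (d i) (R i) ` V i)
      \<in> {V. subrep r d X V \<and> U \<le> V} \<rightarrow> {W. subrep r e Y W}" by auto
next
  fix V assume "V \<in> {V. subrep r d X V \<and> U \<le> V}"
  then have V: "subrep r d X V" "U \<le> V" by auto
  have "x \<in> V i" if "x \<in> vecs (d i)" "v \<in> V i"
    "mapply (e i) (d i) (R i) x = mapply (e i) (d i) (R i) v" for x v i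
  proof -
    have "x - v \<in> U i"
      unfolding quot_map_simps(2)[symmetric]
      using that subrep_subspace(3)[OF V(1), of i]
      by (auto simp: vp.linear_diff[OF linear_mapply] intro!: vf.subspace_diff[OF subspace_vecs])
    then have "(x - v) + v \<in> V i"
      using V(2) that(2) by (intro vf.subspace_add[OF subrep_subspace(2)[OF V(1)]]) (auto simp: le_fun_def)
    then show ?thesis by simp
  qed
  then show "rep_preimage d e R (\<lambda>i. mapply (e i) (d i) (R i) ` V i) = V"
    using subrep_subspace(3)[OF V(1)] by (fastforce simp: rep_preimage_def fun_eq_iff)
qed (simp add: image_rep_preimage)

text \<open>The third isomorphism theorem: the composite of the two quotient maps has the preimage
  of \<open>W\<close> as its kernel.\<close>

lemma quot_iso_trans:
  assumes W: "subrep r e Y W" and Z: "quot_iso r e Y W f Z"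
  shows "quot_iso r d X (rep_preimage d e R W) f Z"
proof -
  obtain S where S: "quot_map r e Y W f Z S" and Zr: "Z \<in> Rep r f"
    using Z by (auto simp: quot_iso_iff)
  have "\<forall>i. \<exists>C. \<forall>x\<in>vecs (d i). mapply (f i) (e i) (S i) (mapply (e i) (d i) (R i) x)
      = mapply (f i) (d i) C x" using mapply_compose by blast
  then obtain C where C: "\<And>i x. x \<in> vecs (d i) \<Longrightarrow>
      mapply (f i) (d i) (C i) x = mapply (f i) (e i) (S i) (mapply (e i) (d i) (R i) x)" by metis
  have "quot_map r d X (rep_preimage d e R W) f Z C"
    unfolding quot_map_def
  proof (intro conjI allI impI)
    fix i
    have "mapply (f i) (d i) (C i) ` vecs (d i)
        = mapply (f i) (e i) (S i) ` mapply (e i) (d i) (R i) ` vecs (d i)"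
      unfolding image_image using C by (intro image_cong) auto
    then show "mapply (f i) (d i) (C i) ` vecs (d i) = vecs (f i)"
      using S by (simp add: quot_map_simps(1) quot_map_def)
    have "W i = {y \<in> vecs (e i). mapply (f i) (e i) (S i) y = 0}"
      using S by (simp add: quot_map_def)
    then show "{x \<in> vecs (d i). mapply (f i) (d i) (C i) x = 0} = rep_preimage d e R W i"
      using C by (auto simp: rep_preimage_def)
  next
    fix i j m and x :: "nat \<Rightarrow> 'k" assume "m < r i j" "x \<in> vecs (d i)"
    then show "mapply (f j) (d j) (C j) (mapply (d j) (d i) (X i j m) x)
      = mapply (f j) (f i) (Z i j m) (mapply (f i) (d i) (C i) x)"
      using S by (simp add: C quot_map_simps(3) quot_map_def)
  qed
  then show ?thesis using Zr by (auto simp: quot_iso_iff)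
qed

end

section \<open>Hall products count flags\<close>

text \<open>Chains \<open>U = U\<^sub>0 \<subseteq> U\<^sub>1 \<subseteq> \<dots>\<close> with steps of the prescribed dimension types; the last step is not
  summed over, since it can only end in the whole representation.\<close>

primrec flags :: "('i::finite \<Rightarrow> 'i \<Rightarrow> nat) \<Rightarrow> 'i dimv \<Rightarrow> ('i,'k::{field,finite}) qrep \<Rightarrow> 'i dimv list
     \<Rightarrow> ('i \<Rightarrow> (nat \<Rightarrow> 'k) set) \<Rightarrow> real" where
  "flags r d X [] U = 1"
| "flags r d X (a # ds) U = (if ds = [] then 1 else
     \<Sum>V\<in>{V. subrep r d X V \<and> U \<le> V \<and> subdimv d V = subdimv d U + a}. flags r d X ds V)"

lemma euler_0_left: "euler r 0 b = 0"
  by (simp add: euler_def)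

lemma euler_add_left: "euler r (a + b) c = euler r a c + euler r b c"
  by (simp add: euler_def sum.distrib algebra_simps)

text \<open>The pairs involving the first entry add up, by additivity, to exactly the twist exponent
  of the Hall product of \<open>chi r a\<close> with the remaining factors.\<close>

lemma tuple_form_Cons: "tuple_form r (a # ds) = euler r (sum_list ds) a + tuple_form r ds"
proof -
  have "(\<Sum>l<length ds. euler r (ds ! l) a) = euler r (sum_list ds) a"
    by (induction ds) (simp_all add: euler_0_left euler_add_left sum.lessThan_Suc_shift
        del: sum.lessThan_Suc plus_fun_apply zero_fun_apply)
  then show ?thesis
    by (simp add: tuple_form_def sum.lessThan_Suc_shift sum.distrib del: sum.lessThan_Suc)
qed

text \<open>Stated for every model \<open>Y\<close> of a quotient of \<open>X\<close> so that the
  induction closes: a quotient of \<open>Y\<close> by \<open>W\<close> is the quotient of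
  \<open>X\<close> by the preimage of \<open>W\<close>, and all flags stay inside the fixed
  \<open>X\<close>.\<close>

lemma chiprod_flags:
  fixes X :: "('i::finite, 'k::{field,finite}) qrep"
  assumes "subrep r d X U" and "ds \<noteq> []" and "quot_iso r d X U (sum_list ds) Y"
  shows "chiprod r ds Y = sqrt (real CARD('k)) powi tuple_form r ds * flags r d X ds U"
  using assms
proof (induction r ds arbitrary: U Y rule: chiprod.induct)
  case (1 r)
  then show ?case by simp
next
  case (2 r a)
  then show ?case by (simp add: chi_def quot_iso_def tuple_form_def)
next
  case (3 r a b ds)
  let ?v = "sqrt (real CARD('k))" and ?e = "sum_list (b # ds)"
  obtain R where R: "quot_map r d X U (a + ?e) Y R" using "3.prems"(3) unfolding sum_list.Cons[of a] quot_iso_iff by blast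
  let ?pre = "rep_preimage d (a + ?e) R"
  note U = "3.prems"(1)
  let ?c = "?v powi tuple_form r (b # ds)"
  \<comment> \<open>The first factor is the indicator that \<open>W\<close> has type
    \<open>a\<close>; the second is evaluated by the induction hypothesis at
    \<open>?pre W\<close>.\<close>
  have *: "hval_sub r (a + ?e) Y W a (chi r a) * hval_quot r (a + ?e) Y W ?e (chiprod r (b # ds))
      = (if subdimv (a + ?e) W = a then ?c * flags r d X (b # ds) (?pre W) else 0)"
    if W: "subrep r (a + ?e) Y W" for W
  proof (cases "subdimv (a + ?e) W = a")
    case True
    then have "\<exists>Z. sub_iso r (a + ?e) Y W a Z" using sub_iso_iff[OF W] by blast
    moreover from someI_ex[OF this]
    have "(SOME Z. sub_iso r (a + ?e) Y W a Z) \<in> Rep r a" by (auto simp: sub_iso_def)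
    ultimately have 1: "hval_sub r (a + ?e) Y W a (chi r a) = 1" by (simp add: hval_sub_def chi_def)
    have ex: "\<exists>Z. quot_iso r (a + ?e) Y W ?e Z"
      using True by (intro quot_iso_exists[OF W]) simp
    \<comment> \<open>Whichever model \<open>SOME\<close> picks, it is a quotient of
      \<open>X\<close> by \<open>?pre W\<close>, which is all that the induction hypothesis
      asks.\<close>
    from someI_ex[OF this]
    have "quot_iso r d X (?pre W) ?e (SOME Z. quot_iso r (a + ?e) Y W ?e Z)"
      by (rule quot_iso_trans[OF U R W])
    from "3.IH"[OF subrep_preimage(1)[OF U R W] _ this] ex
    have "hval_quot r (a + ?e) Y W ?e (chiprod r (b # ds)) = ?c * flags r d X (b # ds) (?pre W)"
      unfolding hval_quot_def by (simp only: if_True) simp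
    with 1 True show ?thesis by simp
  next
    case False
    then show ?thesis using sub_iso_iff[OF W] by (simp add: hval_sub_def)
  qed
  \<comment> \<open>Taking the preimage adds the type of \<open>U\<close>, so a subrepresentation of
    \<open>Y\<close> of type \<open>a\<close> becomes a step of type \<open>a\<close> above
    \<open>U\<close>.\<close>
  have "(\<Sum>W\<in>{W. subrep r (a + ?e) Y W}.
        hval_sub r (a + ?e) Y W a (chi r a) * hval_quot r (a + ?e) Y W ?e (chiprod r (b # ds)))
      = (\<Sum>W\<in>{W. subrep r (a + ?e) Y W}. if subdimv d (?pre W) = subdimv d U + a
          then ?c * flags r d X (b # ds) (?pre W) else 0)"
    by (intro sum.cong refl) (simp only: * subdimv_preimage[OF U R] mem_Collect_eq add_left_cancel)
  also have "\<dots> = (\<Sum>V\<in>{V. subrep r d X V \<and> U \<le> V}. if subdimv d V = subdimv d U + a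
          then ?c * flags r d X (b # ds) V else 0)"
    by (rule sum.reindex_bij_betw[OF bij_betw_preimage[OF U R]])
  also have "\<dots> = (\<Sum>V\<in>{V. subrep r d X V \<and> U \<le> V \<and> subdimv d V = subdimv d U + a}.
          ?c * flags r d X (b # ds) V)"
    using finite_subset[OF _ finite_subreps[of r d X], of "{V. subrep r d X V \<and> U \<le> V}"]
    by (subst sum.inter_filter[symmetric]) (auto intro!: sum.cong)
  also have "\<dots> = ?c * flags r d X (a # b # ds) U"
    by (simp add: sum_distrib_left del: flags.simps add: flags.simps(2)[of r d X a])
  finally have "chiprod r (a # b # ds) Y = ?v powi euler r ?e a * (?c * flags r d X (a # b # ds) U)"
    by (simp only: chiprod.simps hmult_def)
  moreover have "?v powi tuple_form r (a # b # ds) = ?v powi euler r ?e a * ?c"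
    unfolding tuple_form_Cons[of r a] by (rule power_int_add) simp
  ultimately show ?case by (simp only: mult.assoc)
qed

lemma finite_dimv_le: "finite {b :: 'i::finite dimv. b \<le> d}"
proof (rule finite_subset)
  show "{b. b \<le> d} \<subseteq> (\<Pi>\<^sub>E i\<in>UNIV. {..d i})" by (auto simp: le_fun_def PiE_UNIV_domain)
qed (auto intro!: finite_PiE)

section \<open>Alternating sums over flags\<close>

text \<open>Tuples are read as paths of dimension types from \<open>a\<close> to \<open>d\<close>
  with intermediate points satisfying \<open>Q\<close>. The variable starting point keeps the family
  stable under removal of the first entry.\<close>

definition cut_tuples :: "'i dimv \<Rightarrow> ('i dimv \<Rightarrow> bool) \<Rightarrow> 'i dimv \<Rightarrow> 'i dimv list set" where
  "cut_tuples d Q a = {ds. ds \<noteq> [] \<and> (\<forall>x\<in>set ds. x \<noteq> 0) \<and> a + sum_list ds = d \<and>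
      (\<forall>k. 1 \<le> k \<and> k < length ds \<longrightarrow> Q (a + sum_list (take k ds)))}"

lemma hn_tuples_eq: "hn_tuples \<Theta> d = cut_tuples d (\<lambda>b. slope \<Theta> b > slope \<Theta> d) 0"
  by (simp add: hn_tuples_def cut_tuples_def del: zero_fun_apply plus_fun_apply)

lemma dimv_add_diff: "a \<le> b \<Longrightarrow> a + (b - a) = (b :: 'i dimv)"
  by (auto simp: fun_eq_iff le_fun_def)

lemma dimv_less_add: "x \<noteq> 0 \<Longrightarrow> a < a + (x :: 'i dimv)"
  by (auto simp: less_fun_def le_fun_def fun_eq_iff)

lemma sum_list_dimv_nonzero:
  assumes "ds \<noteq> []" and "\<forall>x\<in>set ds. x \<noteq> (0 :: 'i dimv)"
  shows "sum_list ds \<noteq> 0"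
proof -
  obtain a es where ds: "ds = a # es" using assms(1) by (cases ds) auto
  then obtain i where "a i \<noteq> 0" using assms(2) by (auto simp: fun_eq_iff)
  then have "sum_list ds i \<noteq> 0" using ds by simp
  then show ?thesis by (metis zero_fun_apply)
qed

lemma Cons_in_cut_tuples:
  assumes "ds \<noteq> []"
  shows "e # ds \<in> cut_tuples d Q a \<longleftrightarrow> e \<noteq> 0 \<and> Q (a + e) \<and> ds \<in> cut_tuples d Q (a + e)"
proof -
  have "(\<forall>k. 1 \<le> k \<and> k < length (e # ds) \<longrightarrow> Q (a + sum_list (take k (e # ds))))
    \<longleftrightarrow> (\<forall>k < length ds. Q (a + e + sum_list (take k ds)))"
  proof (intro iffI allI impI)
    fix k assume *: "\<forall>k. 1 \<le> k \<and> k < length (e # ds) \<longrightarrow> Q (a + sum_list (take k (e # ds)))"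
      and "k < length ds"
    then show "Q (a + e + sum_list (take k ds))" using *[rule_format, of "Suc k"]
      by (simp add: add.assoc del: plus_fun_apply)
  next
    fix k assume *: "\<forall>k < length ds. Q (a + e + sum_list (take k ds))"
      and k: "1 \<le> k \<and> k < length (e # ds)"
    then obtain l where "k = Suc l" by (cases k) auto
    then show "Q (a + sum_list (take k (e # ds)))" using * k
      by (simp add: add.assoc del: plus_fun_apply)
  qed
  \<comment> \<open>The index 0 stands for the empty partial sum of \<open>ds\<close>; it occurs
    because \<open>ds\<close> is nonempty, and it contributes the condition at
    \<open>a + e\<close>.\<close>
  also have "\<dots> \<longleftrightarrow> Q (a + e) \<and> (\<forall>k. 1 \<le> k \<and> k < length ds \<longrightarrow> Q (a + e + sum_list (take k ds)))"
  proof (intro iffI conjI allI impI)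
    assume *: "\<forall>k < length ds. Q (a + e + sum_list (take k ds))"
    then show "Q (a + e)" using assms *[rule_format, of 0]
      by (simp del: plus_fun_apply zero_fun_apply)
  next
    fix k assume *: "Q (a + e) \<and> (\<forall>k. 1 \<le> k \<and> k < length ds \<longrightarrow> Q (a + e + sum_list (take k ds)))"
      and "k < length ds"
    then show "Q (a + e + sum_list (take k ds))"
      by (cases k) (simp_all del: plus_fun_apply zero_fun_apply)
  qed auto
  finally show ?thesis using assms
    by (simp add: cut_tuples_def add.assoc conj_ac del: plus_fun_apply zero_fun_apply)
qed

text \<open>A path either jumps straight to \<open>d\<close> or has a first intermediate point
  \<open>b\<close>, strictly below \<open>d\<close> because the remaining entries are nonzero.
  Truncated subtraction is exact here, as \<open>a \<le> b\<close> and
  \<open>a \<le> d\<close>.\<close>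

lemma cut_tuples_rec:
  assumes "a < d"
  shows "cut_tuples d Q a
    = insert [d - a] (\<Union>b\<in>{b. a < b \<and> b < d \<and> Q b}. (#) (b - a) ` cut_tuples d Q b)"
    (is "_ = insert _ ?S")
proof (intro set_eqI iffI)
  fix ds assume ds: "ds \<in> cut_tuples d Q a"
  then obtain e es where e: "ds = e # es" by (cases ds) (auto simp: cut_tuples_def)
  show "ds \<in> insert [d - a] ?S"
  proof (cases "es = []")
    case True
    then have "a + e = d" using ds e by (simp add: cut_tuples_def del: plus_fun_apply)
    then have "e = d - a" by auto
    then show ?thesis using True e by simp
  next
    case False
    then have e': "e \<noteq> 0" "Q (a + e)" "es \<in> cut_tuples d Q (a + e)"
      using ds Cons_in_cut_tuples e by blast+
    then have "a + e + sum_list es = d" "\<forall>x\<in>set es. x \<noteq> 0" by (auto simp: cut_tuples_def)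
    then have "a + e < d"
      using dimv_less_add[OF sum_list_dimv_nonzero[OF False], of "a + e"] by simp
    moreover have "a < a + e" using e'(1) by (rule dimv_less_add)
    moreover have "e = (a + e) - a" by auto
    ultimately have "ds \<in> ?S" using e' e by blast
    then show ?thesis by simp
  qed
next
  fix ds assume "ds \<in> insert [d - a] ?S"
  then show "ds \<in> cut_tuples d Q a"
  proof
    assume "ds = [d - a]"
    moreover have "d - a \<noteq> 0"
      using dimv_add_diff[of a d] assms by (auto simp: less_le)
    ultimately show ?thesis using dimv_add_diff[of a d] assms
      by (auto simp: cut_tuples_def less_le simp del: plus_fun_apply)
  next
    assume "ds \<in> ?S"
    then obtain b es where b: "a < b" "b < d" "Q b" "es \<in> cut_tuples d Q b" "ds = (b - a) # es"
      by blast
    have ab: "a + (b - a) = b" using b(1) by (intro dimv_add_diff less_imp_le)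
    then have "b - a \<noteq> 0" using b(1) by auto
    moreover have "es \<noteq> []" using b(4) by (auto simp: cut_tuples_def)
    ultimately show ?thesis using Cons_in_cut_tuples[of es "b - a" d Q a] b ab by simp
  qed
qed

text \<open>Induction on the number of dimension types above \<open>a\<close> and up to
  \<open>d\<close>, which drops when the path moves on to \<open>b\<close>.\<close>

lemma finite_cut_tuples: "a < d \<Longrightarrow> finite (cut_tuples d Q (a :: 'i::finite dimv))"
proof (induction "card {b. a < b \<and> b \<le> d}" arbitrary: a rule: less_induct)
  case less
  have fin: "finite {b. a < b \<and> b \<le> d}" 
    by (rule finite_subset[OF _ finite_dimv_le[of d]]) (auto intro: less_imp_le)
  have "finite (cut_tuples d Q b)" if b: "a < b" "b < d" for b
  proof -
    have "{c. b < c \<and> c \<le> d} \<subseteq> {c. a < c \<and> c \<le> d}"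
      using b(1) less_trans by blast
    moreover have "b \<in> {c. a < c \<and> c \<le> d}" "b \<notin> {c. b < c \<and> c \<le> d}"
      using b less_imp_le by blast+
    ultimately have "card {c. b < c \<and> c \<le> d} < card {c. a < c \<and> c \<le> d}"
      by (intro psubset_card_mono[OF fin] psubsetI) blast+
    then show ?thesis by (rule less.hyps) (rule b(2))
  qed
  moreover have "finite {b. a < b \<and> b < d \<and> Q b}" by (rule finite_subset[OF _ fin]) auto
  ultimately show ?case unfolding cut_tuples_rec[OF less.prems] by auto
qed

text \<open>The union in \<open>cut_tuples_rec\<close> is disjoint: the first entry
  \<open>b - a\<close> determines \<open>b\<close>, and only the one-step path has an empty
  tail.\<close>

lemma sum_cut_tuples:
  fixes g :: "'i::finite dimv list \<Rightarrow> real"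
  assumes "a < d"
  shows "(\<Sum>ds\<in>cut_tuples d Q a. g ds) = g [d - a]
    + (\<Sum>b\<in>{b. a < b \<and> b < d \<and> Q b}. \<Sum>ds\<in>cut_tuples d Q b. g ((b - a) # ds))"
proof -
  let ?B = "{b. a < b \<and> b < d \<and> Q b}"
  have finB: "finite ?B" 
    by (rule finite_subset[OF _ finite_dimv_le[of d]]) (auto intro: less_imp_le)
  have fin: "finite ((#) (b - a) ` cut_tuples d Q b)" if "b \<in> ?B" for b
    using finite_cut_tuples[of b d Q] that by auto
  have disj: "(#) (b - a) ` cut_tuples d Q b \<inter> (#) (c - a) ` cut_tuples d Q c = {}"
    if "b \<in> ?B" "c \<in> ?B" "b \<noteq> c" for b c
  proof -
    have "b - a \<noteq> c - a"
      using that dimv_add_diff[of a b] dimv_add_diff[of a c] by (auto simp: less_le)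
    then show ?thesis by auto
  qed
  have "[d - a] \<notin> (\<Union>b\<in>?B. (#) (b - a) ` cut_tuples d Q b)" by (auto simp: cut_tuples_def)
  then have "(\<Sum>ds\<in>cut_tuples d Q a. g ds)
      = g [d - a] + (\<Sum>ds\<in>(\<Union>b\<in>?B. (#) (b - a) ` cut_tuples d Q b). g ds)"
    unfolding cut_tuples_rec[OF assms] using finB fin by (subst sum.insert) auto
  also have "(\<Sum>ds\<in>(\<Union>b\<in>?B. (#) (b - a) ` cut_tuples d Q b). g ds)
      = (\<Sum>b\<in>?B. \<Sum>ds\<in>(#) (b - a) ` cut_tuples d Q b. g ds)"
    using finB fin disj by (intro sum.UNION_disjoint) auto
  also have "\<dots> = (\<Sum>b\<in>?B. \<Sum>ds\<in>cut_tuples d Q b. g ((b - a) # ds))"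
    by (rule sum.cong[OF refl]) (simp add: sum.reindex)
  finally show ?thesis .
qed

text \<open>The exponent is the number of intermediate members of a flag from \<open>U\<close> to
  the whole representation. At the zero subrepresentation, with \<open>Q\<close> the slope
  condition, this is the right-hand side of the theorem.\<close>

definition alternating_flags :: "('i::finite \<Rightarrow> 'i \<Rightarrow> nat) \<Rightarrow> 'i dimv \<Rightarrow> ('i,'k::{field,finite}) qrep
     \<Rightarrow> ('i dimv \<Rightarrow> bool) \<Rightarrow> ('i \<Rightarrow> (nat \<Rightarrow> 'k) set) \<Rightarrow> real" where
  "alternating_flags r d X Q U
    = (\<Sum>ds\<in>cut_tuples d Q (subdimv d U). (-1) ^ (length ds - 1) * flags r d X ds U)"

text \<open>Flags are sorted by their first intermediate member \<open>V\<close>: the one-step flag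
  contributes 1, and prepending a step reverses the sign. Since \<open>Q d\<close> fails, such a
  \<open>V\<close> never has the full dimension type.\<close>

lemma alternating_flags_rec:
  fixes X :: "('i::finite, 'k::{field,finite}) qrep"
  assumes U: "subrep r d X U" and d: "subdimv d U \<noteq> d" and Q: "\<not> Q d"
  shows "alternating_flags r d X Q U
    = 1 - (\<Sum>V\<in>{V. subrep r d X V \<and> Q (subdimv d V) \<and> U < V}. alternating_flags r d X Q V)"
proof -
  let ?a = "subdimv d U"
  let ?B = "{b. ?a < b \<and> b < d \<and> Q b}"
  let ?S = "\<lambda>b. {V. subrep r d X V \<and> U \<le> V \<and> subdimv d V = b}"
  have less: "?a < d" using d subdimv_le[OF U] by simp
  have finB: "finite ?B" 
    by (rule finite_subset[OF _ finite_dimv_le[of d]]) (auto intro: less_imp_le)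
  have finS: "finite (?S b)" for b by (rule finite_subset[OF _ finite_subreps[of r d X]]) auto
  have inner: "(\<Sum>ds\<in>cut_tuples d Q b. (-1) ^ (length ((b - ?a) # ds) - 1) * flags r d X ((b - ?a) # ds) U)
      = (\<Sum>V\<in>?S b. - alternating_flags r d X Q V)" if "b \<in> ?B" for b
  proof -
    have ab: "?a + (b - ?a) = b" using that by (intro dimv_add_diff less_imp_le) simp
    have "(\<Sum>ds\<in>cut_tuples d Q b. (-1) ^ (length ((b - ?a) # ds) - 1) * flags r d X ((b - ?a) # ds) U)
        = (\<Sum>ds\<in>cut_tuples d Q b. \<Sum>V\<in>?S b. - ((-1) ^ (length ds - 1) * flags r d X ds V))"
    proof (rule sum.cong[OF refl])
      fix ds assume "ds \<in> cut_tuples d Q b"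
      then have ne: "ds \<noteq> []" by (simp add: cut_tuples_def)
      \<comment> \<open>Both truncated differences are exact, as \<open>ds\<close> is
        nonempty.\<close>
      have "(-1) ^ (length ((b - ?a) # ds) - 1) = - ((-1 :: real) ^ (length ds - 1))"
        using ne by (cases ds) auto
      moreover have "flags r d X ((b - ?a) # ds) U = (\<Sum>V\<in>?S b. flags r d X ds V)"
        unfolding flags.simps ab using ne by simp
      ultimately show "(-1) ^ (length ((b - ?a) # ds) - 1) * flags r d X ((b - ?a) # ds) U
          = (\<Sum>V\<in>?S b. - ((-1) ^ (length ds - 1) * flags r d X ds V))"
        by (simp only: sum_distrib_left mult_minus_left)
    qed
    also have "\<dots> = (\<Sum>V\<in>?S b. \<Sum>ds\<in>cut_tuples d Q b. - ((-1) ^ (length ds - 1) * flags r d X ds V))"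
      by (rule sum.swap)
    also have "\<dots> = (\<Sum>V\<in>?S b. - alternating_flags r d X Q V)"
      by (intro sum.cong refl) (auto simp: alternating_flags_def sum_negf)
    finally show ?thesis .
  qed
  \<comment> \<open>Collecting over all types gives every \<open>V\<close> strictly above
    \<open>U\<close> satisfying \<open>Q\<close>: strict inclusion raises the type, and
    \<open>Q\<close> excludes \<open>d\<close>.\<close>
  have union: "(\<Union>b\<in>?B. ?S b) = {V. subrep r d X V \<and> Q (subdimv d V) \<and> U < V}"
  proof (intro set_eqI iffI)
    fix V assume "V \<in> (\<Union>b\<in>?B. ?S b)"
    then show "V \<in> {V. subrep r d X V \<and> Q (subdimv d V) \<and> U < V}" by (auto simp: less_le)
  next
    fix V assume "V \<in> {V. subrep r d X V \<and> Q (subdimv d V) \<and> U < V}"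
    then have V: "subrep r d X V" "Q (subdimv d V)" "U < V" by auto
    have "subdimv d V \<noteq> d" using V(2) Q by auto
    then have "subdimv d V \<in> ?B"
      using V subdimv_strict_mono[OF U V(1,3)] subdimv_le[OF V(1)] by (auto simp: less_le)
    then show "V \<in> (\<Union>b\<in>?B. ?S b)" using V by auto
  qed
  have "alternating_flags r d X Q U = 1 + (\<Sum>b\<in>?B. \<Sum>V\<in>?S b. - alternating_flags r d X Q V)"
    unfolding alternating_flags_def[of _ _ _ _ U] sum_cut_tuples[OF less]
    by (simp only: inner cong: sum.cong) simp
  also have "(\<Sum>b\<in>?B. \<Sum>V\<in>?S b. - alternating_flags r d X Q V)
      = (\<Sum>V\<in>(\<Union>b\<in>?B. ?S b). - alternating_flags r d X Q V)"
    using finB finS by (intro sum.UNION_disjoint[symmetric]) auto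
  finally show ?thesis unfolding union by (simp add: sum_negf)
qed

section \<open>Vanishing over a contractible poset\<close>

text \<open>The recursion says that \<open>F U\<close> is minus the reduced Euler characteristic of the order complex
  of \<open>{V \<in> P. U < V}\<close>; that poset is contracted onto a point by \<open>V \<le> V \<squnion> u \<ge> U \<squnion> u\<close>.\<close>

lemma cone_sum_zero:
  fixes F :: "'a::order \<Rightarrow> real"
  assumes fin: "finite P"
    and rec: "\<And>U. U \<in> insert z P \<Longrightarrow> F U = 1 - (\<Sum>V\<in>{V \<in> P. U < V}. F V)"
    and join: "\<And>U. U \<in> insert z P \<Longrightarrow> \<exists>J\<in>P. \<forall>V\<in>P. J \<le> V \<longleftrightarrow> U \<le> V \<and> u \<le> V"
  shows "U \<in> insert z P \<Longrightarrow> \<not> u \<le> U \<Longrightarrow> F U = 0"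
proof (induction "card {V \<in> P. U < V}" arbitrary: U rule: less_induct)
  case less
  let ?A = "{V \<in> P. U < V}"
  obtain J where J: "J \<in> P" "\<And>V. V \<in> P \<Longrightarrow> J \<le> V \<longleftrightarrow> U \<le> V \<and> u \<le> V"
    using join[OF less.prems(1)] by blast
  \<comment> \<open>Elements above \<open>U\<close> but not above \<open>u\<close> vanish by
    induction, having fewer elements of \<open>P\<close> strictly above them.\<close>
  have "F V = 0" if V: "V \<in> ?A" "\<not> u \<le> V" for V
  proof (rule less.hyps)
    have "{W \<in> P. V < W} \<subset> ?A" using V by auto
    then show "card {W \<in> P. V < W} < card ?A" using fin by (intro psubset_card_mono) auto
  qed (use V in auto)
  then have "(\<Sum>V\<in>?A. F V) = (\<Sum>V\<in>{V \<in> ?A. u \<le> V}. F V)"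
    using fin by (intro sum.mono_neutral_right) auto
  \<comment> \<open>The surviving elements are those above the join \<open>J\<close>;
    \<open>J\<close> is itself strictly above \<open>U\<close> because \<open>u\<close> is not below
    \<open>U\<close>. The recursion at \<open>J\<close> then gives the sum 1.\<close>
  also have "{V \<in> ?A. u \<le> V} = insert J {V \<in> P. J < V}"
    using J less.prems(2) by (auto simp: less_le)
  also have "(\<Sum>V\<in>\<dots>. F V) = 1" using fin rec[of J] J(1) by simp
  finally show ?case using rec[OF less.prems(1)] by simp
qed

text \<open>The slope inequality with denominators cleared. Unlike the slope it is additive, and it vanishes
  at 0, where the slope is a junk value.\<close>

definition theta_excess :: "('i::finite \<Rightarrow> int) \<Rightarrow> 'i dimv \<Rightarrow> 'i dimv \<Rightarrow> int" where
  "theta_excess \<Theta> d b = (\<Sum>i\<in>UNIV. \<Theta> i * int (b i)) * int (\<Sum>i\<in>UNIV. d i)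
      - (\<Sum>i\<in>UNIV. \<Theta> i * int (d i)) * int (\<Sum>i\<in>UNIV. b i)"

lemma theta_excess_add: "theta_excess \<Theta> d (a + b) = theta_excess \<Theta> d a + theta_excess \<Theta> d b"
  by (simp add: theta_excess_def sum.distrib algebra_simps)

lemma theta_excess_zero: "theta_excess \<Theta> d 0 = 0"
  by (simp add: theta_excess_def)

lemma theta_excess_self: "theta_excess \<Theta> d d = 0"
  by (simp add: theta_excess_def)

text \<open>Multiply by the two total dimensions, which are positive for nonzero vectors.\<close>

lemma slope_less_iff:
  fixes b d :: "'i::finite dimv"
  assumes "b \<noteq> 0" and "d \<noteq> 0"
  shows "slope \<Theta> d < slope \<Theta> b \<longleftrightarrow> 0 < theta_excess \<Theta> d b"
proof -
  have pos: "0 < (\<Sum>i\<in>UNIV. c i)" if "c \<noteq> 0" for c :: "'i dimv"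
    using that by (auto simp: fun_eq_iff intro: ccontr)
  let ?n = "\<lambda>c :: 'i dimv. real (\<Sum>i\<in>UNIV. c i)" and ?t = "\<lambda>c. real_of_int (\<Sum>i\<in>UNIV. \<Theta> i * int (c i))"
  have frac: "x / p < y / q \<longleftrightarrow> x * q < y * p" if "0 < p" "0 < q" for x y p q :: real
    using that by (simp add: field_simps)
  have "0 < ?n b" "0 < ?n d" using pos[OF assms(1)] pos[OF assms(2)] by (simp_all del: of_nat_sum)
  then have "slope \<Theta> d < slope \<Theta> b \<longleftrightarrow> ?t d * ?n b < ?t b * ?n d"
    unfolding slope_def by (intro frac)
  also have "\<dots> \<longleftrightarrow> real_of_int 0 < real_of_int (theta_excess \<Theta> d b)"
    unfolding theta_excess_def by simp
  finally show ?thesis by (simp only: of_int_less_iff)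
qed

section \<open>Evaluation at a representation and contraction of its destabilizing poset\<close>

theorem mainTheorem11:
  fixes r :: "'i::finite \<Rightarrow> 'i \<Rightarrow> nat" and \<Theta> :: "'i \<Rightarrow> int" and d :: "'i \<Rightarrow> nat"
  assumes "acyclic {(i, j). 0 < r i j}"
    and "d \<noteq> 0"
  shows "\<forall>X :: ('i, 'k::{field,finite}) qrep. X \<in> Rep r d \<longrightarrow>
     chi_ss r \<Theta> d X =
       (\<Sum>ds\<in>hn_tuples \<Theta> d. (-1) ^ (length ds - 1) * sqrt (real (card (UNIV :: 'k set))) powi (- tuple_form r ds)
          * chiprod r ds X)"
proof (intro allI impI)
  fix X :: "('i, 'k) qrep" assume X: "X \<in> Rep r d"
  let ?v = "sqrt (real CARD('k))" and ?Q = "\<lambda>b. 0 < theta_excess \<Theta> d b"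
  let ?z = "\<lambda>_ :: 'i. {0 :: nat \<Rightarrow> 'k}"
  let ?F = "alternating_flags r d X ?Q"
  define P where "P = {V. subrep r d X V \<and> ?Q (subdimv d V)}"
  have finP: "finite P" unfolding P_def by (rule finite_subset[OF _ finite_subreps[of r d X]]) auto

  \<comment> \<open>The partial sums in question are nonempty sums of nonzero entries, so the slope
    condition may be replaced by positive excess.\<close>
  have "hn_tuples \<Theta> d = cut_tuples d ?Q 0"
  proof -
    have "slope \<Theta> d < slope \<Theta> (sum_list (take k ds)) \<longleftrightarrow> ?Q (sum_list (take k ds))"
      if "\<forall>x\<in>set ds. x \<noteq> 0" "1 \<le> k" "k < length ds" for ds k
      using that by (intro slope_less_iff assms(2) sum_list_dimv_nonzero) (auto dest: in_set_takeD)
    then show ?thesis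
      unfolding hn_tuples_eq cut_tuples_def by (auto simp del: plus_fun_apply zero_fun_apply)
  qed
  moreover have "?v powi (- tuple_form r ds) * chiprod r ds X = flags r d X ds ?z"
    if "ds \<in> hn_tuples \<Theta> d" for ds
  proof -
    have ds: "ds \<noteq> []" "sum_list ds = d" using that by (auto simp: hn_tuples_def)
    then have "chiprod r ds X = ?v powi tuple_form r ds * flags r d X ds ?z"
      using chiprod_flags[OF subrep_bot] quot_iso_bot[OF X] by blast
    then show ?thesis by (simp add: power_int_minus)
  qed
  ultimately have sum_eq: "(\<Sum>ds\<in>hn_tuples \<Theta> d. (-1) ^ (length ds - 1)
      * sqrt (real (card (UNIV :: 'k set))) powi (- tuple_form r ds) * chiprod r ds X) = ?F ?z"
    by (simp only: alternating_flags_def subdimv_bot mult.assoc cong: sum.cong)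

  \<comment> \<open>The whole representation is not in \<open>insert ?z P\<close>: its excess is 0,
    and \<open>d\<close> is nonzero.\<close>
  have rec: "?F U = 1 - (\<Sum>V\<in>{V \<in> P. U < V}. ?F V)" if "U \<in> insert ?z P" for U
  proof -
    have "subrep r d X U" using that subrep_bot by (auto simp: P_def)
    moreover have "subdimv d U \<noteq> d"
      using that assms(2) theta_excess_self[of \<Theta> d] subdimv_bot[of d, where 'k = 'k]
      by (auto simp: P_def)
    ultimately show ?thesis
      using alternating_flags_rec[of r d X U ?Q] theta_excess_self[of \<Theta> d]
      by (simp add: P_def conj_assoc)
  qed

  \<comment> \<open>Semistability leaves out subrepresentations of type 0; so does \<open>P\<close>,
    because their excess is 0.\<close>
  have ss: "semistable r \<Theta> d X \<longleftrightarrow> P = {}"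
  proof -
    have "slope \<Theta> (subdimv d U) \<le> slope \<Theta> d \<longleftrightarrow> \<not> ?Q (subdimv d U)" if "subdimv d U \<noteq> 0" for U
      using slope_less_iff[OF that assms(2), of \<Theta>] by (simp add: not_less[symmetric])
    then show ?thesis
      unfolding semistable_def P_def using X theta_excess_zero[of \<Theta> d]
      by (metis (mono_tags, lifting) empty_Collect_eq less_irrefl)
  qed

  have "?F ?z = (if P = {} then 1 else 0)"
  proof (cases "P = {}")
    case True
    then show ?thesis using rec[of ?z] by simp
  next
    case False
    let ?\<phi> = "\<lambda>U. theta_excess \<Theta> d (subdimv d U)"
    have fin: "finite (?\<phi> ` {U. subrep r d X U})" by (intro finite_imageI finite_subreps)
    have ne: "?\<phi> ` {U. subrep r d X U} \<noteq> {}" using subrep_bot by blast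
    obtain u where u: "subrep r d X u" "?\<phi> u = Max (?\<phi> ` {U. subrep r d X U})"
      using Max_in[OF fin ne] by auto
    have max: "?\<phi> U \<le> ?\<phi> u" if "subrep r d X U" for U
      unfolding u(2) using that by (intro Max_ge fin imageI) simp
    \<comment> \<open>Some member of \<open>P\<close> has positive excess, hence so does the
      maximizer \<open>u\<close>.\<close>
    then have uP: "u \<in> P" using False u(1) by (force simp: P_def)
    have join: "rep_sum U u \<in> P" if U: "U \<in> insert ?z P" for U
    proof -
      have sU: "subrep r d X U" using U subrep_bot by (auto simp: P_def)
      \<comment> \<open>As the intersection has excess at most that of \<open>u\<close>, adding
        \<open>u\<close> cannot lower the excess of \<open>U\<close>.\<close>
      have *: "?\<phi> U + ?\<phi> u = ?\<phi> (\<lambda>i. U i \<inter> u i) + ?\<phi> (rep_sum U u)"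
        using subdimv_rep_sum[OF sU u(1)] by (metis theta_excess_add)
      then have le: "?\<phi> U \<le> ?\<phi> (rep_sum U u)" using max[OF subrep_inter[OF sU u(1)]] by linarith
      show ?thesis
      \<comment> \<open>For \<open>U\<close> in \<open>P\<close> that bound suffices. The zero
        subrepresentation has excess 0 only, but its sum with \<open>u\<close> has the positive
        excess of \<open>u\<close>.\<close>
      proof (cases "U = ?z")
        case True
        have "(\<lambda>i. U i \<inter> u i) = ?z"
          using True vf.subspace_0[OF subrep_subspace(2)[OF u(1)]] by auto
        then have "?\<phi> (rep_sum U u) = ?\<phi> u"
          using * True by (simp add: subdimv_bot theta_excess_zero del: zero_fun_apply)
        then show ?thesis using uP subrep_rep_sum[OF sU u(1)] by (simp add: P_def)
      next
        case False
        then show ?thesis using U le subrep_rep_sum[OF sU u(1)]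
          by (auto simp: P_def)
      qed
    qed
    have "?F ?z = 0"
    proof (rule cone_sum_zero[OF finP rec])
      fix U assume U: "U \<in> insert ?z P"
      then have "subrep r d X U" using subrep_bot by (auto simp: P_def)
      then show "\<exists>J\<in>P. \<forall>V\<in>P. J \<le> V \<longleftrightarrow> U \<le> V \<and> u \<le> V"
        using join[OF U] rep_sum_le_iff[OF _ u(1)] by (intro bexI[of _ "rep_sum U u"]) (auto simp: P_def)
    next
      \<comment> \<open>Otherwise \<open>u\<close> would have type 0 and excess 0, contrary to
        membership in \<open>P\<close>.\<close>
      show "\<not> u \<le> ?z"
      proof
        assume "u \<le> ?z"
        then have "subdimv d u \<le> 0"
          using subdimv_mono[OF u(1) subrep_bot] subdimv_bot[of d, where 'k = 'k] by metis
        then have "subdimv d u = 0" by (auto simp: le_fun_def fun_eq_iff)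
        then show False using uP theta_excess_zero[of \<Theta> d] by (simp add: P_def)
      qed
    qed auto
    then show ?thesis using False by simp
  qed
  then show "chi_ss r \<Theta> d X =
       (\<Sum>ds\<in>hn_tuples \<Theta> d. (-1) ^ (length ds - 1) * sqrt (real (card (UNIV :: 'k set))) powi (- tuple_form r ds)
          * chiprod r ds X)"
    unfolding sum_eq chi_ss_def ss by simp
qed

end
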